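(* Let $n\ge1$ and let $\phi(t)$ be an element of $\mathcal{P}_{(v_0,w_1,\ldots,w_n)}$; put $w_0=v_0$. A pair $(\rho,\sigma)\in\mathcal{A}=\mathrm{Diff}(\mathbb{C},0)\times\mathrm{Diff}(\mathbb{C}^{n+1},0)$ satisfies $(\sigma\circ\phi\circ\rho^{-1})(t)\in\mathcal{P}_{(v_0,w_1,\ldots,w_n)}$ if and only if there exist $\epsilon\in\mathbb{C}^*$ and $h_k\in\langle Y_{k+1},\ldots,Y_n\rangle+\mathcal{M}_{n+1}^2$ with $\mathrm{ord}_t(h_k(\phi(t)))>w_k$, for $0\le k\le n$, such that $$\rho(t)=t\cdot\left(\epsilon^{v_0}+\frac{h_0(\phi(t))}{t^{v_0}}\right)^{\frac1{v_0}}$$ and $\sigma(X,\underline{Y})=(\sigma_0(X,\underline{Y}),\ldots,\sigma_n(X,\underline{Y}))$ with $$\sigma_0(X,\underline{Y})=\epsilon^{v_0}X+h_0(X,\underline{Y}),\qquad \sigma_k(X,\underline{Y})=\epsilon^{w_k}Y_k+h_k(X,\underline{Y})\quad(1\le k\le n).$$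
   Context: $\underline{Y}=(Y_1,\ldots,Y_n)$, and $\mathcal{M}_{n+1}=\langle X,Y_1,\ldots,Y_n\rangle$ is the maximal ideal of the convergent power series ring $\mathbb{C}\{X,\underline{Y}\}$; $\langle Y_{k+1},\ldots,Y_n\rangle$ is the zero ideal for $k=n$. The $v_0$-th root in $\rho$ is the branch whose value at $t=0$ is $\epsilon$, i.e. $\rho'(0)=\epsilon$. The order of the zero series is $\infty$. $\mathrm{Diff}(\mathbb{C}^l,0)$ is the group of germs of analytic diffeomorphisms of $(\mathbb{C}^l,0)$. A parametrization is an analytic map-germ $\phi=(p_0,\ldots,p_n):(\mathbb{C},0)\to(\mathbb{C}^{n+1},0)$, always assumed primitive (not of the form $\psi(\tau(t))$ with $\mathrm{ord}_t\,\tau\ge2$) and non-degenerate (no $\sigma\circ\phi\circ\rho^{-1}$ with $(\rho,\sigma)\in\mathcal{A}$ has an identically zero component). Its value semigroup is $\Gamma=\{\mathrm{ord}_t(g(\phi(t))) : g\in\mathbb{C}\{X,\underline{Y}\},\ g(\phi(t))\neq 0\}$, and for $1\le i\le n$, $\Gamma_i=\{\mathrm{ord}_t(h(p_0,\ldots,p_{i-1})) : h\in\mathbb{C}\{X,Y_1,\ldots,Y_{i-1}\},\ h(p_0,\ldots,p_{i-1})\ne 0\}$. $\mathcal{P}_{(v_0,w_1,\ldots,w_n)}$ is the set of parametrizations $\phi(t)=(t^{v_0},y_1(t),\ldots,y_n(t))$ such that $y_i(t)=t^{w_i}+(\text{terms of order}>w_i)$ and $w_i=\min(\Gamma\setminus\Gamma_i)$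 for $1\le i\le n$, with $v_0=w_0<w_1<\cdots<w_n$ and $v_0=\min(\Gamma\setminus\{0\})$. *)

theory Defs
  imports
    "HOL-Analysis.Analysis"
    "HOL-Library.Poly_Mapping"
    "HOL-Algebra.Ideal_Product"
begin

section \<open>Multivariate power series\<close>

text \<open>
  A multi-index is a finitely supported function on the variable numbers. The variable with number
  \<open>0\<close> is \<open>X\<close>, the one with number \<open>k \<ge> 1\<close> is \<open>Y\<^sub>k\<close>. The type has countably many
  variables; the number of variables is bounded by the carriers \<open>conv_mps m\<close> below.
\<close>

type_synonym mindex = "nat \<Rightarrow>\<^sub>0 nat"

definition mdeg :: "mindex \<Rightarrow> nat" where
  "mdeg \<alpha> = (\<Sum>i\<in>Poly_Mapping.keys \<alpha>. Poly_Mapping.lookup \<alpha> i)"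

definition mpower :: "(nat \<Rightarrow> 'a) \<Rightarrow> mindex \<Rightarrow> 'a :: comm_monoid_mult" where
  "mpower p \<alpha> = (\<Prod>i\<in>Poly_Mapping.keys \<alpha>. p i ^ Poly_Mapping.lookup \<alpha> i)"

definition splits :: "mindex \<Rightarrow> (mindex \<times> mindex) set" where
  "splits \<gamma> = {(\<alpha>, \<beta>). \<alpha> + \<beta> = \<gamma>}"

lemma finite_splits [simp]: "finite (splits \<gamma>)"
proof -
  let ?K = "Poly_Mapping.keys \<gamma>" and ?M = "Max (Poly_Mapping.lookup \<gamma> ` Poly_Mapping.keys \<gamma>)"
  let ?B = "{g. \<forall>i. (i \<in> ?K \<longrightarrow> g i \<in> {..?M}) \<and> (i \<notin> ?K \<longrightarrow> g i = (0 :: nat))}"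
  let ?C = "{\<alpha>. Poly_Mapping.lookup \<alpha> \<in> ?B}"
  have "finite ?B"
    by (rule finite_set_of_finite_funs) auto
  moreover have "inj Poly_Mapping.lookup"
    by (rule injI) (simp add: poly_mapping_eqI)
  ultimately have C: "finite ?C"
    using finite_vimageI by (fastforce simp: vimage_def)
  have inC: "\<alpha> \<in> ?C" if "\<And>i. Poly_Mapping.lookup \<alpha> i \<le> Poly_Mapping.lookup \<gamma> i" for \<alpha>
  proof -
    have "Poly_Mapping.lookup \<alpha> i \<le> ?M" if "i \<in> ?K" for i
      by (rule order_trans[OF \<open>\<And>i. Poly_Mapping.lookup \<alpha> i \<le> Poly_Mapping.lookup \<gamma> i\<close>])
         (use that in \<open>simp add: Max_ge\<close>)
    moreover have "Poly_Mapping.lookup \<alpha> i = 0" if "i \<notin> ?K" for i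
      using that \<open>\<And>i. Poly_Mapping.lookup \<alpha> i \<le> Poly_Mapping.lookup \<gamma> i\<close>[of i]
      by (simp add: in_keys_iff)
    ultimately show ?thesis by simp
  qed
  have "splits \<gamma> \<subseteq> ?C \<times> ?C"
  proof (clarify, intro conjI SigmaI)
    fix \<alpha> \<beta> assume "(\<alpha>, \<beta>) \<in> splits \<gamma>"
    then have \<gamma>: "\<gamma> = \<alpha> + \<beta>" by (simp add: splits_def)
    show "\<alpha> \<in> ?C" "\<beta> \<in> ?C" by (rule inC, simp add: \<gamma> lookup_add)+
  qed
  then show ?thesis
    using C finite_subset by blast
qed

typedef 'a mps = "UNIV :: (mindex \<Rightarrow> 'a) set"
  morphisms mps_coeff Abs_mps ..

setup_lifting type_definition_mps

lemma mps_eqI: "(\<And>\<alpha>. mps_coeff f \<alpha> = mps_coeff g \<alpha>) \<Longrightarrow> f = g"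
  by transfer auto

instantiation mps :: (comm_ring_1) comm_ring_1
begin

lift_definition zero_mps :: "'a mps" is "\<lambda>_. 0" .
lift_definition one_mps :: "'a mps" is "\<lambda>\<alpha>. if \<alpha> = 0 then 1 else 0" .
lift_definition plus_mps :: "'a mps \<Rightarrow> 'a mps \<Rightarrow> 'a mps" is "\<lambda>f g \<alpha>. f \<alpha> + g \<alpha>" .
lift_definition minus_mps :: "'a mps \<Rightarrow> 'a mps \<Rightarrow> 'a mps" is "\<lambda>f g \<alpha>. f \<alpha> - g \<alpha>" .
lift_definition uminus_mps :: "'a mps \<Rightarrow> 'a mps" is "\<lambda>f \<alpha>. - f \<alpha>" .
lift_definition times_mps :: "'a mps \<Rightarrow> 'a mps \<Rightarrow> 'a mps"
  is "\<lambda>f g \<gamma>. \<Sum>(\<alpha>, \<beta>)\<in>splits \<gamma>. f \<alpha> * g \<beta>" .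

instance
proof
  fix f g h :: "'a mps"
  show "f * g * h = f * (g * h)"
  proof (transfer, rule ext)
    fix f g h :: "mindex \<Rightarrow> 'a" and \<gamma>
    have "(\<Sum>(\<delta>, c)\<in>splits \<gamma>. (\<Sum>(a, b)\<in>splits \<delta>. f a * g b) * h c)
        = (\<Sum>(\<delta>, c)\<in>splits \<gamma>. \<Sum>(a, b)\<in>splits \<delta>. f a * g b * h c)"
      by (simp add: sum_distrib_right case_prod_unfold)
    also have "\<dots> = (\<Sum>(x, y)\<in>Sigma (splits \<gamma>) (\<lambda>x. splits (fst x)). f (fst y) * g (snd y) * h (snd x))"
      by (subst sum.Sigma[symmetric]) (auto simp: case_prod_unfold)
    also have "\<dots> = (\<Sum>(x, y)\<in>Sigma (splits \<gamma>) (\<lambda>x. splits (snd x)). f (fst x) * (g (fst y) * h (snd y)))"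
      by (rule sum.reindex_bij_witness[where
            i = "\<lambda>(x, y). ((fst x + fst y, snd y), (fst x, fst y))" and
            j = "\<lambda>(x, y). ((fst y, snd y + snd x), (snd y, snd x))"])
         (auto simp: splits_def add.assoc mult.assoc)
    also have "\<dots> = (\<Sum>(a, \<delta>)\<in>splits \<gamma>. \<Sum>(b, c)\<in>splits \<delta>. f a * (g b * h c))"
      by (subst sum.Sigma[symmetric]) (auto simp: case_prod_unfold)
    also have "\<dots> = (\<Sum>(a, \<delta>)\<in>splits \<gamma>. f a * (\<Sum>(b, c)\<in>splits \<delta>. g b * h c))"
      by (simp add: sum_distrib_left case_prod_unfold)
    finally show "(\<Sum>(\<delta>, c)\<in>splits \<gamma>. (\<Sum>(a, b)\<in>splits \<delta>. f a * g b) * h c)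
        = (\<Sum>(a, \<delta>)\<in>splits \<gamma>. f a * (\<Sum>(b, c)\<in>splits \<delta>. g b * h c))" .
  qed
  show "f * g = g * f"
    by (transfer, rule ext, rule sum.reindex_bij_witness[where i = prod.swap and j = prod.swap])
       (auto simp: splits_def add.commute mult.commute)
  show "1 * f = f"
  proof (transfer, rule ext)
    fix f :: "mindex \<Rightarrow> 'a" and \<gamma>
    have "(\<Sum>(\<alpha>, \<beta>)\<in>splits \<gamma>. (if \<alpha> = 0 then 1 else 0) * f \<beta>)
        = (\<Sum>(\<alpha>, \<beta>)\<in>{(0 :: mindex, \<gamma>)}. (if \<alpha> = 0 then 1 else 0) * f \<beta>)"
      by (intro sum.mono_neutral_right finite_splits) (auto simp: splits_def split: if_splits)
    then show "(\<Sum>(\<alpha>, \<beta>)\<in>splits \<gamma>. (if \<alpha> = 0 then 1 else 0) * f \<beta>) = f \<gamma>"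
      by simp
  qed
  show "(f + g) * h = f * h + g * h"
    by transfer (simp add: fun_eq_iff distrib_right sum.distrib case_prod_unfold)
  show "(0 :: 'a mps) \<noteq> 1"
    by transfer (auto simp: fun_eq_iff)
qed (transfer; simp add: fun_eq_iff algebra_simps)+

end

lift_definition mps_const :: "'a \<Rightarrow> 'a::zero mps" is "\<lambda>c \<alpha>. if \<alpha> = 0 then c else 0" .

lift_definition mps_var :: "nat \<Rightarrow> 'a::zero_neq_one mps" is
  "\<lambda>i \<alpha>. if \<alpha> = Poly_Mapping.single i 1 then 1 else 0" .

text \<open>
  Substitution is the coefficientwise sum \<open>\<Sum>\<alpha>. f\<^sub>\<alpha> p\<^sup>\<alpha>\<close>. It is only used for \<open>f\<close> in finitely
  many variables and \<open>p\<close> without constant terms; then each of the sums below has finitely many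
  nonzero terms, as \<^const>\<open>Sum_any\<close> requires.
\<close>

definition mps_subst_fps :: "complex mps \<Rightarrow> (nat \<Rightarrow> complex fps) \<Rightarrow> complex fps" where
  "mps_subst_fps f p = Abs_fps (\<lambda>m. Sum_any (\<lambda>\<alpha>. mps_coeff f \<alpha> * fps_nth (mpower p \<alpha>) m))"

definition mps_compose :: "complex mps \<Rightarrow> (nat \<Rightarrow> complex mps) \<Rightarrow> complex mps" where
  "mps_compose f s = Abs_mps (\<lambda>\<beta>. Sum_any (\<lambda>\<alpha>. mps_coeff f \<alpha> * mps_coeff (mpower s \<alpha>) \<beta>))"


section \<open>Convergent power series and germs\<close>

text \<open>
  Germs of analytic functions at the origin are identified with their Taylor series:
  \<open>conv_fps\<close> is \<open>\<complex>{t}\<close> and \<open>conv_mps m\<close> is \<open>\<complex>{X, Y\<^sub>1, \<dots>, Y\<^bsub>m-1\<^esub>}\<close>, the power series in the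
  variables with numbers below \<open>m\<close> that converge absolutely on some polydisc.
\<close>

definition conv_fps :: "complex fps set" where
  "conv_fps = {f. fps_conv_radius f > 0}"

definition conv_mps :: "nat \<Rightarrow> complex mps set" where
  "conv_mps m = {f. (\<forall>\<alpha>. mps_coeff f \<alpha> \<noteq> 0 \<longrightarrow> Poly_Mapping.keys \<alpha> \<subseteq> {..<m}) \<and>
     (\<exists>r>0. (\<lambda>\<alpha>. norm (mps_coeff f \<alpha>) * r ^ mdeg \<alpha>) summable_on UNIV)}"

definition conv_ring :: "nat \<Rightarrow> complex mps ring" where
  "conv_ring m = \<lparr>carrier = conv_mps m, mult = (*), one = 1, zero = 0, add = (+)\<rparr>"

definition max_ideal :: "nat \<Rightarrow> complex mps set" where
  "max_ideal m = Idl\<^bsub>conv_ring m\<^esub> (mps_var ` {..<m})"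

text \<open>
  Maps between germs of \<open>\<complex>\<^sup>l\<close> are tuples indexed by \<open>nat\<close>, of which only the components with
  index below the dimension matter.
\<close>

definition diff1 :: "complex fps set" where
  "diff1 = {\<rho>. \<rho> \<in> conv_fps \<and> fps_nth \<rho> 0 = 0 \<and>
     (\<exists>\<tau>\<in>conv_fps. fps_nth \<tau> 0 = 0 \<and> fps_compose \<rho> \<tau> = fps_X \<and> fps_compose \<tau> \<rho> = fps_X)}"

definition map_germs :: "nat \<Rightarrow> (nat \<Rightarrow> complex mps) set" where
  "map_germs l = {\<sigma>. \<forall>i<l. \<sigma> i \<in> conv_mps l \<and> mps_coeff (\<sigma> i) 0 = 0}"

definition diffs :: "nat \<Rightarrow> (nat \<Rightarrow> complex mps) set" where
  "diffs l = {\<sigma> \<in> map_germs l. \<exists>\<tau> \<in> map_germs l.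
     \<forall>i<l. mps_compose (\<sigma> i) \<tau> = mps_var i \<and> mps_compose (\<tau> i) \<sigma> = mps_var i}"

definition A_group :: "nat \<Rightarrow> (complex fps \<times> (nat \<Rightarrow> complex mps)) set" where
  "A_group n = diff1 \<times> diffs (n + 1)"

text \<open>\<open>A_act \<rho> \<sigma> \<phi>\<close> is \<open>\<sigma> \<circ> \<phi> \<circ> \<rho>\<^sup>-\<^sup>1\<close>; \<^const>\<open>fps_inv\<close> is the compositional inverse.\<close>

definition A_act ::
    "complex fps \<Rightarrow> (nat \<Rightarrow> complex mps) \<Rightarrow> (nat \<Rightarrow> complex fps) \<Rightarrow> nat \<Rightarrow> complex fps" where
  "A_act \<rho> \<sigma> \<phi> = (\<lambda>i. fps_compose (mps_subst_fps (\<sigma> i) \<phi>) (fps_inv \<rho>))"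


section \<open>Parametrizations\<close>

definition fps_ord :: "complex fps \<Rightarrow> enat" where
  "fps_ord f = (if f = 0 then \<infinity> else enat (subdegree f))"

definition curve_germs :: "nat \<Rightarrow> (nat \<Rightarrow> complex fps) set" where
  "curve_germs n = {\<phi>. \<forall>i\<le>n. \<phi> i \<in> conv_fps \<and> fps_nth (\<phi> i) 0 = 0}"

definition primitive_germ :: "nat \<Rightarrow> (nat \<Rightarrow> complex fps) \<Rightarrow> bool" where
  "primitive_germ n \<phi> \<longleftrightarrow> \<not> (\<exists>\<psi> \<tau>. \<psi> \<in> curve_germs n \<and> \<tau> \<in> conv_fps \<and> fps_nth \<tau> 0 = 0 \<and>
     fps_ord \<tau> \<ge> 2 \<and> (\<forall>i\<le>n. \<phi> i = fps_compose (\<psi> i) \<tau>))"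

definition nondegenerate :: "nat \<Rightarrow> (nat \<Rightarrow> complex fps) \<Rightarrow> bool" where
  "nondegenerate n \<phi> \<longleftrightarrow> (\<forall>(\<rho>, \<sigma>)\<in>A_group n. \<forall>i\<le>n. A_act \<rho> \<sigma> \<phi> i \<noteq> 0)"

definition parametrizations :: "nat \<Rightarrow> (nat \<Rightarrow> complex fps) set" where
  "parametrizations n = {\<phi> \<in> curve_germs n. primitive_germ n \<phi> \<and> nondegenerate n \<phi>}"

text \<open>
  \<open>value_set m \<phi>\<close> only uses the components \<open>\<phi> 0, \<dots>, \<phi> (m - 1)\<close>. The value semigroup \<open>\<Gamma>\<close> of a
  parametrization in \<open>\<complex>\<^bsup>n+1\<^esup>\<close> is \<open>value_set (n + 1) \<phi>\<close>, and \<open>\<Gamma>\<^sub>i\<close> is \<open>value_set i \<phi>\<close>.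
\<close>

definition value_set :: "nat \<Rightarrow> (nat \<Rightarrow> complex fps) \<Rightarrow> nat set" where
  "value_set m \<phi> =
     {subdegree (mps_subst_fps g \<phi>) |g. g \<in> conv_mps m \<and> mps_subst_fps g \<phi> \<noteq> 0}"

definition is_min :: "nat \<Rightarrow> nat set \<Rightarrow> bool" where
  "is_min a S \<longleftrightarrow> a \<in> S \<and> (\<forall>s\<in>S. a \<le> s)"

text \<open>\<open>P_class n v w\<close> is the set \<open>\<P>\<close> with index \<open>(v, w 1, \<dots>, w n)\<close>.\<close>

definition P_class :: "nat \<Rightarrow> nat \<Rightarrow> (nat \<Rightarrow> nat) \<Rightarrow> (nat \<Rightarrow> complex fps) set" where
  "P_class n v w = {\<phi> \<in> parametrizations n.
     \<phi> 0 = fps_X ^ v \<and>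
     is_min v (value_set (n + 1) \<phi> - {0}) \<and>
     (\<forall>i\<in>{1..n}. fps_ord (\<phi> i - fps_X ^ w i) > enat (w i) \<and>
        is_min (w i) (value_set (n + 1) \<phi> - value_set i \<phi>)) \<and>
     (n \<ge> 1 \<longrightarrow> v < w 1) \<and> (\<forall>i\<in>{1..<n}. w i < w (i + 1))}"

end

theory Submission
  imports Defs
begin

text \<open>
  On a curve in the class, a series whose linear part starts with \<open>Y\<^sub>k\<close> has order at most \<open>w k\<close>:
  otherwise subtracting the \<open>Y\<^sub>k\<close> term would leave a series of order exactly \<open>w k\<close>, and after discarding
  the monomials of higher order this series only involves the variables before \<open>Y\<^sub>k\<close>, so
  \<open>w k\<close> would lie in \<open>\<Gamma>\<^sub>k\<close>. Comparing leading terms, this yields the shape of \<open>\<sigma>\<close>. Conversely, a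
  \<open>\<sigma>\<close> of this shape has a triangular linear part, which keeps \<open>w k\<close> outside \<open>\<Gamma>\<^sub>k\<close>. That \<open>w k\<close>
  is the least such value follows from the orders of the components alone, nondegeneracy of the new
  curve is the order bound above, and being primitive is invariant under the action.
\<close>

section \<open>Multi-indices\<close>

text \<open>Neither \<open>\<epsilon>\<close> nor \<open>\<rho>\<close> is free. Component
  \<open>0\<close> of the new curve is again a pure power of \<open>t\<close>, so composing it with
  \<open>\<rho>\<close> shows that \<open>\<rho>\<close> to the power \<open>w 0\<close> is
  \<open>\<sigma> 0\<close> evaluated on the old curve. This fixes \<open>\<rho>\<close> up to a
  root of unity, which \<open>\<epsilon>\<close>, the derivative of \<open>\<rho>\<close> at the
  origin, selects. The factors \<open>\<epsilon> ^ w k\<close> have the same source: composing a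
  series of order \<open>w k\<close> with \<open>\<rho>\<close> multiplies its leading coefficient
  by this power. Membership in the sum of ideals only restricts the constant and linear
  coefficients, so order bounds on the curve must be converted into information on linear parts. The
  obstacle is that a series in earlier variables might cancel the leading term of a later component;
  the gap condition on the \<open>w k\<close> excludes exactly this. Orders see only finitely many
  coefficients, so most of the argument is formal and passes to polynomials. Estimates enter for the
  transformed curve, for transporting a factorization through \<open>\<tau>\<close>, and for the
  ideals of convergent series.\<close>

text \<open>The order in \<open>t\<close> of the monomial \<open>\<alpha>\<close> on a curve whose
  component \<open>i\<close> has order \<open>w i\<close>. Total degree is the case of all weights
  equal to \<open>1\<close>.\<close>

definition weight :: "(nat \<Rightarrow> nat) \<Rightarrow> mindex \<Rightarrow> nat" where
  "weight w \<alpha> = (\<Sum>i\<in>Poly_Mapping.keys \<alpha>. Poly_Mapping.lookup \<alpha> i * w i)"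

definition evec :: "nat \<Rightarrow> mindex" where
  "evec i = Poly_Mapping.single i 1"

text \<open>Series without constant term raise the order by at least the degree, so these monomials
  are the only ones that can contribute up to order \<open>d\<close>. The set turns the sums
  \<open>Sum_any\<close> into finite ones.\<close>

definition midx :: "nat \<Rightarrow> nat \<Rightarrow> mindex set" where
  "midx l d = {\<alpha>. Poly_Mapping.keys \<alpha> \<subseteq> {..<l} \<and> mdeg \<alpha> \<le> d}"

lemma keys_add_nat:
  "Poly_Mapping.keys (\<alpha> + \<beta> :: mindex) = Poly_Mapping.keys \<alpha> \<union> Poly_Mapping.keys \<beta>"
  by (auto simp: in_keys_iff lookup_add)

lemma weight_superset:
  assumes "finite A" "Poly_Mapping.keys \<alpha> \<subseteq> A"
  shows "weight w \<alpha> = (\<Sum>i\<in>A. Poly_Mapping.lookup \<alpha> i * w i)"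
  unfolding weight_def using assms by (intro sum.mono_neutral_left) (auto simp: in_keys_iff)

lemma mpower_superset:
  assumes "finite A" "Poly_Mapping.keys \<alpha> \<subseteq> A"
  shows "mpower p \<alpha> = (\<Prod>i\<in>A. p i ^ Poly_Mapping.lookup \<alpha> i)"
  unfolding mpower_def using assms by (intro prod.mono_neutral_left) (auto simp: in_keys_iff)

lemma weight_add: "weight w (\<alpha> + \<beta>) = weight w \<alpha> + weight w \<beta>"
proof -
  let ?A = "Poly_Mapping.keys \<alpha> \<union> Poly_Mapping.keys \<beta>"
  show ?thesis
    by (simp add: weight_superset[of ?A] keys_add_nat lookup_add distrib_right sum.distrib)
qed

lemma mpower_add: "mpower p (\<alpha> + \<beta>) = mpower p \<alpha> * mpower p \<beta>"
proof -
  let ?A = "Poly_Mapping.keys \<alpha> \<union> Poly_Mapping.keys \<beta>"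
  show ?thesis
    by (simp add: mpower_superset[of ?A] keys_add_nat lookup_add power_add prod.distrib)
qed

lemma mdeg_weight: "mdeg \<alpha> = weight (\<lambda>_. 1) \<alpha>"
  by (simp add: mdeg_def weight_def)

lemma mdeg_add: "mdeg (\<alpha> + \<beta>) = mdeg \<alpha> + mdeg \<beta>"
  by (simp add: mdeg_weight weight_add)

lemma weight_0 [simp]: "weight w 0 = 0"
  by (simp add: weight_def)

lemma mdeg_0 [simp]: "mdeg 0 = 0"
  by (simp add: mdeg_def)

lemma mpower_0 [simp]: "mpower p 0 = 1"
  by (simp add: mpower_def)

lemma keys_evec [simp]: "Poly_Mapping.keys (evec i) = {i}"
  by (simp add: evec_def)

lemma lookup_evec: "Poly_Mapping.lookup (evec i) j = (if i = j then 1 else 0)"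
  by (simp add: evec_def lookup_single when_def)

lemma weight_evec [simp]: "weight w (evec i) = w i"
  by (simp add: weight_def lookup_evec)

lemma mdeg_evec [simp]: "mdeg (evec i) = 1"
  by (simp add: mdeg_weight)

lemma mpower_evec [simp]: "mpower p (evec i) = p i"
  by (simp add: mpower_def lookup_evec)

lemma evec_inject [simp]: "evec i = evec j \<longleftrightarrow> i = j"
  by (metis keys_evec singleton_inject)

lemma evec_nonzero [simp]: "evec i \<noteq> 0"
  by (metis keys_evec keys_zero insert_not_empty)

lemma mindex_split_var:
  assumes "j \<in> Poly_Mapping.keys (\<alpha> :: mindex)"
  obtains \<beta> where "\<alpha> = evec j + \<beta>"
proof
  show "\<alpha> = evec j + (\<alpha> - evec j)"
    using assms
    by (intro poly_mapping_eqI) (auto simp: lookup_add lookup_minus lookup_evec in_keys_iff)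
qed

lemma mdeg_eq_0_iff [simp]: "mdeg \<alpha> = 0 \<longleftrightarrow> \<alpha> = 0"
  by (auto simp: mdeg_def in_keys_iff intro!: poly_mapping_eqI)

lemma mdeg_1_imp_evec:
  assumes "mdeg \<alpha> = 1"
  obtains j where "\<alpha> = evec j"
proof -
  from assms have "\<alpha> \<noteq> 0" by auto
  then obtain j where "j \<in> Poly_Mapping.keys \<alpha>" by fastforce
  then obtain \<beta> where \<beta>: "\<alpha> = evec j + \<beta>" by (rule mindex_split_var)
  with assms have "mdeg \<beta> = 0" by (simp add: mdeg_add)
  then show thesis using \<beta> that by simp
qed

lemma mdeg_le_weight:
  assumes "\<And>i. i \<in> Poly_Mapping.keys \<alpha> \<Longrightarrow> 1 \<le> w i"
  shows "mdeg \<alpha> \<le> weight w \<alpha>"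
  unfolding mdeg_def weight_def using assms by (intro sum_mono) auto

lemma finite_midx [simp]: "finite (midx l d)"
proof -
  let ?B = "{g. \<forall>i. (i \<in> {..<l} \<longrightarrow> g i \<in> {..d}) \<and> (i \<notin> {..<l} \<longrightarrow> g i = (0 :: nat))}"
  have "finite ?B"
    by (rule finite_set_of_finite_funs) auto
  moreover have "inj Poly_Mapping.lookup"
    by (rule injI) (simp add: poly_mapping_eqI)
  ultimately have "finite (Poly_Mapping.lookup -` ?B)"
    by (rule finite_vimageI)
  moreover have "Poly_Mapping.lookup \<alpha> i \<le> d" if "mdeg \<alpha> \<le> d" for \<alpha> i
  proof (cases "i \<in> Poly_Mapping.keys \<alpha>")
    case True
    then have "Poly_Mapping.lookup \<alpha> i \<le> mdeg \<alpha>"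
      unfolding mdeg_def by (intro member_le_sum) auto
    then show ?thesis using that by simp
  qed (simp add: in_keys_iff)
  then have "midx l d \<subseteq> Poly_Mapping.lookup -` ?B"
    by (auto simp: midx_def in_keys_iff)
  ultimately show ?thesis by (rule finite_subset[rotated])
qed

lemma splits_0: "splits 0 = {(0, 0)}"
  by (auto simp: splits_def poly_mapping_eq_iff lookup_add fun_eq_iff)

lemma splits_evec: "splits (evec i) = {(0, evec i), (evec i, 0)}"
proof -
  have "\<alpha> = 0 \<and> \<beta> = evec i \<or> \<alpha> = evec i \<and> \<beta> = 0" if "\<alpha> + \<beta> = evec i" for \<alpha> \<beta>
  proof -
    have "mdeg \<alpha> + mdeg \<beta> = 1"
      using that by (metis mdeg_add mdeg_evec)
    then have "mdeg \<alpha> = 0 \<or> mdeg \<beta> = 0" by linarith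
    then show ?thesis using that by auto
  qed
  then show ?thesis by (auto simp: splits_def)
qed


section \<open>Coefficients of multivariate power series\<close>

lemma coeff_add [simp]: "mps_coeff (f + g) \<alpha> = mps_coeff f \<alpha> + mps_coeff g \<alpha>"
  by (simp add: plus_mps.rep_eq)

lemma coeff_diff [simp]: "mps_coeff (f - g) \<alpha> = mps_coeff f \<alpha> - mps_coeff g \<alpha>"
  by (simp add: minus_mps.rep_eq)

lemma coeff_uminus [simp]: "mps_coeff (- f) \<alpha> = - mps_coeff f \<alpha>"
  by (simp add: uminus_mps.rep_eq)

lemma coeff_0 [simp]: "mps_coeff 0 \<alpha> = 0"
  by (simp add: zero_mps.rep_eq)

lemma coeff_1: "mps_coeff 1 \<alpha> = (if \<alpha> = 0 then 1 else 0)"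
  by (simp add: one_mps.rep_eq)

lemma coeff_mult: "mps_coeff (f * g) \<gamma> = (\<Sum>(\<alpha>, \<beta>)\<in>splits \<gamma>. mps_coeff f \<alpha> * mps_coeff g \<beta>)"
  by (simp add: times_mps.rep_eq)

lemma coeff_var: "mps_coeff (mps_var i) \<alpha> = (if \<alpha> = evec i then 1 else 0)"
  by (simp add: mps_var.rep_eq evec_def)

lemma coeff_sum [simp]: "mps_coeff (\<Sum>i\<in>A. f i) \<alpha> = (\<Sum>i\<in>A. mps_coeff (f i) \<alpha>)"
  by (induction A rule: infinite_finite_induct) auto

lemma coeff_mult_0: "mps_coeff (f * g) 0 = mps_coeff f 0 * mps_coeff g 0"
  by (simp add: coeff_mult splits_0)

text \<open>The product rule at the origin: a monomial of degree \<open>1\<close> splits only with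
  one factor constant. In particular a product of two series without constant terms has no linear
  part.\<close>

lemma coeff_mult_evec:
  "mps_coeff (f * g) (evec i) = mps_coeff f 0 * mps_coeff g (evec i) + mps_coeff f (evec i) * mps_coeff g 0"
  by (simp add: coeff_mult splits_evec)

lemma coeff_const_mult [simp]: "mps_coeff (mps_const c * f) \<gamma> = c * mps_coeff f \<gamma>"
  for c :: "'a :: comm_ring_1"
proof -
  have "mps_coeff (mps_const c * f) \<gamma>
      = (\<Sum>(\<alpha>, \<beta>)\<in>{(0 :: mindex, \<gamma>)}. mps_coeff (mps_const c) \<alpha> * mps_coeff f \<beta>)"
    unfolding coeff_mult
    by (intro sum.mono_neutral_right finite_splits)
       (auto simp: splits_def mps_const.rep_eq split: if_splits)
  then show ?thesis by (simp add: mps_const.rep_eq)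
qed

lemma coeff_var_mult:
  "mps_coeff (mps_var i * f) \<gamma> =
     (if i \<in> Poly_Mapping.keys \<gamma> then mps_coeff f (\<gamma> - evec i) else 0)"
  for f :: "'a :: comm_ring_1 mps"
proof (cases "i \<in> Poly_Mapping.keys \<gamma>")
  case True
  then obtain \<beta> where \<beta>: "\<gamma> = evec i + \<beta>" by (rule mindex_split_var)
  have "mps_coeff (mps_var i * f) \<gamma>
      = (\<Sum>(\<alpha>, \<beta>)\<in>{(evec i, \<beta>)}. mps_coeff (mps_var i) \<alpha> * mps_coeff f \<beta>)"
    unfolding coeff_mult
    by (intro sum.mono_neutral_right finite_splits)
       (auto simp: splits_def coeff_var \<beta> split: if_splits)
  then show ?thesis using True by (simp add: coeff_var \<beta>)
next
  case False
  then have "mps_coeff (mps_var i * f) \<gamma> = 0"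
    unfolding coeff_mult
    by (intro sum.neutral) (auto simp: splits_def coeff_var keys_add_nat split: if_splits)
  then show ?thesis using False by simp
qed

text \<open>The formal counterpart of \<open>conv_mps\<close>: the algebraic laws of substitution
  need finitely many variables but no convergence.\<close>

definition mps_vars :: "nat \<Rightarrow> 'a::zero mps set" where
  "mps_vars l = {f. \<forall>\<alpha>. mps_coeff f \<alpha> \<noteq> 0 \<longrightarrow> Poly_Mapping.keys \<alpha> \<subseteq> {..<l}}"

lemma mps_varsD: "f \<in> mps_vars l \<Longrightarrow> mps_coeff f \<alpha> \<noteq> 0 \<Longrightarrow> Poly_Mapping.keys \<alpha> \<subseteq> {..<l}"
  by (simp add: mps_vars_def)

lemma conv_mps_vars: "f \<in> conv_mps l \<Longrightarrow> f \<in> mps_vars l"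
  by (simp add: conv_mps_def mps_vars_def)

lemma mps_vars_1 [simp]: "1 \<in> mps_vars l"
  by (simp add: mps_vars_def coeff_1)

lemma mps_vars_mult:
  assumes "f \<in> mps_vars l" "g \<in> mps_vars l"
  shows "f * g \<in> mps_vars l"
  unfolding mps_vars_def
proof (intro CollectI allI impI)
  fix \<gamma> assume "mps_coeff (f * g) \<gamma> \<noteq> 0"
  then obtain \<alpha> \<beta> where "(\<alpha>, \<beta>) \<in> splits \<gamma>" "mps_coeff f \<alpha> * mps_coeff g \<beta> \<noteq> 0"
    unfolding coeff_mult by (rule sum.not_neutral_contains_not_neutral) auto
  moreover from this have "mps_coeff f \<alpha> \<noteq> 0" "mps_coeff g \<beta> \<noteq> 0" by auto
  ultimately show "Poly_Mapping.keys \<gamma> \<subseteq> {..<l}"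
    using mps_varsD[OF assms(1), of \<alpha>] mps_varsD[OF assms(2), of \<beta>]
    by (auto simp: splits_def keys_add_nat)
qed

lemma mps_vars_power: "f \<in> mps_vars l \<Longrightarrow> f ^ k \<in> mps_vars l"
  by (induction k) (auto intro: mps_vars_mult)

lemma mps_vars_prod: "(\<And>i. i \<in> A \<Longrightarrow> f i \<in> mps_vars l) \<Longrightarrow> (\<Prod>i\<in>A. f i) \<in> mps_vars l"
  by (induction A rule: infinite_finite_induct) (auto intro: mps_vars_mult)

lemma mps_vars_mpower:
  "(\<And>i. i \<in> Poly_Mapping.keys \<alpha> \<Longrightarrow> s i \<in> mps_vars l) \<Longrightarrow> mpower s \<alpha> \<in> mps_vars l"
  unfolding mpower_def by (intro mps_vars_prod mps_vars_power) auto

definition mps_ord_ge :: "nat \<Rightarrow> 'a::zero mps \<Rightarrow> bool" where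
  "mps_ord_ge k f \<longleftrightarrow> (\<forall>\<alpha>. mdeg \<alpha> < k \<longrightarrow> mps_coeff f \<alpha> = 0)"

lemma mps_ord_ge_mult:
  assumes "mps_ord_ge a f" "mps_ord_ge b g"
  shows "mps_ord_ge (a + b) (f * g)"
  unfolding mps_ord_ge_def
proof (intro allI impI)
  fix \<gamma> assume "mdeg \<gamma> < a + b"
  then have "mdeg \<alpha> < a \<or> mdeg \<beta> < b" if "(\<alpha>, \<beta>) \<in> splits \<gamma>" for \<alpha> \<beta>
    using that by (auto simp: splits_def mdeg_add)
  then show "mps_coeff (f * g) \<gamma> = 0"
    unfolding coeff_mult using assms by (intro sum.neutral) (fastforce simp: mps_ord_ge_def)
qed

lemma mps_ord_ge_power: "mps_ord_ge 1 f \<Longrightarrow> mps_ord_ge k (f ^ k)"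
proof (induction k)
  case (Suc k)
  then show ?case using mps_ord_ge_mult[of 1 f k "f ^ k"] by simp
qed (simp add: mps_ord_ge_def)

lemma mps_ord_ge_prod:
  "(\<And>i. i \<in> A \<Longrightarrow> mps_ord_ge (d i) (f i)) \<Longrightarrow> mps_ord_ge (\<Sum>i\<in>A. d i) (\<Prod>i\<in>A. f i)"
  by (induction A rule: infinite_finite_induct)
     (auto intro: mps_ord_ge_mult simp: mps_ord_ge_def[of 0])

lemma coeff_mpower_eq_0:
  assumes "\<And>i. i \<in> Poly_Mapping.keys \<alpha> \<Longrightarrow> mps_coeff (s i) 0 = 0" and "mdeg \<beta> < mdeg \<alpha>"
  shows "mps_coeff (mpower s \<alpha>) \<beta> = 0"
proof -
  have "mps_ord_ge 1 (s i)" if "i \<in> Poly_Mapping.keys \<alpha>" for i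
    using assms(1)[OF that] by (simp add: mps_ord_ge_def)
  then have "mps_ord_ge (mdeg \<alpha>) (mpower s \<alpha>)"
    unfolding mpower_def mdeg_def by (intro mps_ord_ge_prod mps_ord_ge_power)
  then show ?thesis using assms(2) by (simp add: mps_ord_ge_def)
qed


section \<open>Substitution\<close>

lemma fps_X_power_dvd_iff: "fps_X ^ k dvd f \<longleftrightarrow> (\<forall>m<k. fps_nth f m = 0)"
  for f :: "'a :: field fps"
proof
  assume "fps_X ^ k dvd f"
  then show "\<forall>m<k. fps_nth f m = 0"
    by (auto simp: dvd_def fps_X_power_mult_nth)
next
  assume "\<forall>m<k. fps_nth f m = 0"
  then have "f = fps_X ^ k * fps_shift k f"
    by (intro fps_ext) (auto simp: fps_X_power_mult_nth)
  then show "fps_X ^ k dvd f"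
    by (metis dvd_triv_left)
qed

text \<open>Divisibility by powers of \<open>fps_X\<close> multiplies along products, and it covers
  zero components, for which \<open>subdegree\<close> would be misleading.\<close>

lemma nth_mpower_eq_0:
  fixes p :: "nat \<Rightarrow> 'a :: field fps"
  assumes "\<And>i. i \<in> Poly_Mapping.keys \<alpha> \<Longrightarrow> fps_X ^ w i dvd p i" and "m < weight w \<alpha>"
  shows "fps_nth (mpower p \<alpha>) m = 0"
proof -
  have "(\<Prod>i\<in>Poly_Mapping.keys \<alpha>. (fps_X ^ w i) ^ Poly_Mapping.lookup \<alpha> i) dvd mpower p \<alpha>"
    unfolding mpower_def using assms(1) by (intro prod_dvd_prod dvd_power_same)
  also have "(\<Prod>i\<in>Poly_Mapping.keys \<alpha>. (fps_X ^ w i) ^ Poly_Mapping.lookup \<alpha> i)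
      = (fps_X :: 'a fps) ^ weight w \<alpha>"
    by (simp add: weight_def power_sum mult.commute flip: power_mult)
  finally show ?thesis using assms(2) by (simp add: fps_X_power_dvd_iff)
qed

lemma nth_mpower_eq_0_mdeg:
  fixes p :: "nat \<Rightarrow> 'a :: field fps"
  assumes "\<And>i. i \<in> Poly_Mapping.keys \<alpha> \<Longrightarrow> fps_nth (p i) 0 = 0" and "m < mdeg \<alpha>"
  shows "fps_nth (mpower p \<alpha>) m = 0"
  by (rule nth_mpower_eq_0[of _ "\<lambda>_. 1"])
     (use assms fps_X_power_dvd_iff[of 1] in \<open>auto simp: mdeg_weight\<close>)

lemma mpower_cong:
  "(\<And>i. i \<in> Poly_Mapping.keys \<alpha> \<Longrightarrow> p i = q i) \<Longrightarrow> mpower p \<alpha> = mpower q \<alpha>"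
  by (simp add: mpower_def)

text \<open>The cut-off \<open>d\<close> may exceed \<open>m\<close>, so that one index set serves
  all coefficients up to \<open>d\<close>, as a Cauchy product requires.\<close>

lemma subst_fps_nth:
  assumes "f \<in> mps_vars l" "\<And>i. i < l \<Longrightarrow> fps_nth (p i) 0 = 0" "m \<le> d"
  shows "fps_nth (mps_subst_fps f p) m = (\<Sum>\<alpha>\<in>midx l d. mps_coeff f \<alpha> * fps_nth (mpower p \<alpha>) m)"
proof -
  have "{\<alpha>. mps_coeff f \<alpha> * fps_nth (mpower p \<alpha>) m \<noteq> 0} \<subseteq> midx l d"
  proof
    fix \<alpha> assume \<alpha>: "\<alpha> \<in> {\<alpha>. mps_coeff f \<alpha> * fps_nth (mpower p \<alpha>) m \<noteq> 0}"
    then have "Poly_Mapping.keys \<alpha> \<subseteq> {..<l}"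
      using mps_varsD[OF assms(1), of \<alpha>] by auto
    moreover have "mdeg \<alpha> \<le> m"
      using \<alpha> nth_mpower_eq_0_mdeg[of \<alpha> p m] assms(2) calculation by (force simp: not_less)
    ultimately show "\<alpha> \<in> midx l d" using assms(3) by (simp add: midx_def)
  qed
  then show ?thesis
    unfolding mps_subst_fps_def by (simp add: Sum_any.expand_superset[of "midx l d"])
qed

lemma compose_coeff:
  assumes "f \<in> mps_vars l" "\<And>i. i < l \<Longrightarrow> mps_coeff (s i) 0 = 0" "mdeg \<beta> \<le> d"
  shows "mps_coeff (mps_compose f s) \<beta> = (\<Sum>\<alpha>\<in>midx l d. mps_coeff f \<alpha> * mps_coeff (mpower s \<alpha>) \<beta>)"
proof -
  have "{\<alpha>. mps_coeff f \<alpha> * mps_coeff (mpower s \<alpha>) \<beta> \<noteq> 0} \<subseteq> midx l d"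
  proof
    fix \<alpha> assume \<alpha>: "\<alpha> \<in> {\<alpha>. mps_coeff f \<alpha> * mps_coeff (mpower s \<alpha>) \<beta> \<noteq> 0}"
    then have "Poly_Mapping.keys \<alpha> \<subseteq> {..<l}"
      using mps_varsD[OF assms(1), of \<alpha>] by auto
    moreover have "mdeg \<alpha> \<le> mdeg \<beta>"
      using \<alpha> coeff_mpower_eq_0[of \<alpha> s \<beta>] assms(2) calculation by (force simp: not_less)
    ultimately show "\<alpha> \<in> midx l d" using assms(3) by (simp add: midx_def)
  qed
  then show ?thesis
    unfolding mps_compose_def by (simp add: Abs_mps_inverse Sum_any.expand_superset[of "midx l d"])
qed

lemma subst_fps_cong:
  assumes "f \<in> mps_vars l" "\<And>i. i < l \<Longrightarrow> p i = q i"
  shows "mps_subst_fps f p = mps_subst_fps f q"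
proof -
  have "mps_coeff f \<alpha> * fps_nth (mpower p \<alpha>) m = mps_coeff f \<alpha> * fps_nth (mpower q \<alpha>) m" for \<alpha> m
  proof (cases "mps_coeff f \<alpha> = 0")
    case False
    then have "mpower p \<alpha> = mpower q \<alpha>"
      using mps_varsD[OF assms(1)] assms(2) by (intro mpower_cong) blast
    then show ?thesis by simp
  qed simp
  then show ?thesis unfolding mps_subst_fps_def by presburger
qed

section \<open>Substitution as a homomorphism of algebras\<close>

lemma subst_fps_add:
  assumes "f \<in> mps_vars l" "g \<in> mps_vars l" "\<And>i. i < l \<Longrightarrow> fps_nth (p i) 0 = 0"
  shows "mps_subst_fps (f + g) p = mps_subst_fps f p + mps_subst_fps g p"
proof (rule fps_ext)
  fix m
  have "f + g \<in> mps_vars l"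
    using assms(1,2) by (auto simp: mps_vars_def) (metis add_0 subsetD lessThan_iff)
  then show "fps_nth (mps_subst_fps (f + g) p) m = fps_nth (mps_subst_fps f p + mps_subst_fps g p) m"
    using assms by (simp add: subst_fps_nth[where l = l and d = m] distrib_right sum.distrib)
qed

lemma mps_vars_diff:
  fixes f g :: "'a :: comm_ring_1 mps"
  assumes "f \<in> mps_vars l" "g \<in> mps_vars l"
  shows "f - g \<in> mps_vars l"
  using assms by (auto simp: mps_vars_def) (metis diff_zero lessThan_iff subsetD)

lemma subst_fps_diff:
  assumes "f \<in> mps_vars l" "g \<in> mps_vars l" "\<And>i. i < l \<Longrightarrow> fps_nth (p i) 0 = 0"
  shows "mps_subst_fps (f - g) p = mps_subst_fps f p - mps_subst_fps g p"
proof (rule fps_ext)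
  fix m
  show "fps_nth (mps_subst_fps (f - g) p) m = fps_nth (mps_subst_fps f p - mps_subst_fps g p) m"
    using assms mps_vars_diff[OF assms(1,2)]
    by (simp add: subst_fps_nth[where l = l and d = m] left_diff_distrib sum_subtractf)
qed

lemma mps_vars_const_mult: "f \<in> mps_vars l \<Longrightarrow> mps_const c * f \<in> mps_vars l"
  for f :: "'a :: comm_ring_1 mps"
  by (auto simp: mps_vars_def) (metis lessThan_iff mult_zero_right subsetD)

lemma subst_fps_const_mult:
  assumes "f \<in> mps_vars l" "\<And>i. i < l \<Longrightarrow> fps_nth (p i) 0 = 0"
  shows "mps_subst_fps (mps_const c * f) p = fps_const c * mps_subst_fps f p"
proof (rule fps_ext)
  fix m
  show "fps_nth (mps_subst_fps (mps_const c * f) p) m = fps_nth (fps_const c * mps_subst_fps f p) m"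
    using assms
    by (simp add: subst_fps_nth[where l = l and d = m] mps_vars_const_mult sum_distrib_left mult.assoc)
qed

lemma subst_fps_1: "mps_subst_fps 1 p = 1"
proof (rule fps_ext)
  fix m
  have *: "(if \<alpha> = 0 then 1 else 0) * fps_nth (mpower p \<alpha>) m
      = (if \<alpha> = 0 then fps_nth 1 m else 0)" for \<alpha>
    by auto
  show "fps_nth (mps_subst_fps 1 p) m = fps_nth 1 m"
    unfolding mps_subst_fps_def coeff_1 * fps_nth_Abs_fps
    by (subst Sum_any.expand_superset[of "{0}"]) (auto split: if_splits)
qed

lemma subst_fps_var: "mps_subst_fps (mps_var i) p = p i"
proof (rule fps_ext)
  fix m
  have *: "(if \<alpha> = evec i then 1 else 0) * fps_nth (mpower p \<alpha>) m
      = (if \<alpha> = evec i then fps_nth (p i) m else 0)" for \<alpha>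
    by auto
  show "fps_nth (mps_subst_fps (mps_var i) p) m = fps_nth (p i) m"
    unfolding mps_subst_fps_def coeff_var * fps_nth_Abs_fps
    by (subst Sum_any.expand_superset[of "{evec i}"]) (auto split: if_splits)
qed

lemma subst_fps_mult:
  assumes f: "f \<in> mps_vars l" and g: "g \<in> mps_vars l" and p: "\<And>i. i < l \<Longrightarrow> fps_nth (p i) 0 = 0"
  shows "mps_subst_fps (f * g) p = mps_subst_fps f p * mps_subst_fps g p"
proof (rule fps_ext)
  fix m
  let ?I = "midx l m"
  define F where "F = (\<lambda>(\<alpha>, \<beta>). mps_coeff f \<alpha> * mps_coeff g \<beta> * fps_nth (mpower p (\<alpha> + \<beta>)) m)"
  have "fps_nth (mps_subst_fps (f * g) p) m = (\<Sum>\<gamma>\<in>?I. \<Sum>x\<in>splits \<gamma>. F x)"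
    by (subst subst_fps_nth[OF mps_vars_mult[OF f g] p order_refl])
       (auto intro!: sum.cong simp: F_def coeff_mult sum_distrib_right splits_def)
  also have "\<dots> = (\<Sum>(\<gamma>, x)\<in>Sigma ?I splits. F x)"
    by (subst sum.Sigma) auto
  also have "\<dots> = (\<Sum>x\<in>{(\<alpha>, \<beta>). \<alpha> + \<beta> \<in> ?I}. F x)"
    by (rule sum.reindex_bij_witness[where i = "\<lambda>x. (fst x + snd x, x)" and j = snd])
       (auto simp: splits_def)
  \<comment> \<open>The pairs added here have total degree above \<open>m\<close>, so the monomial
    with exponent \<open>\<alpha> + \<beta>\<close> has order above \<open>m\<close> after
    substitution. On the full square the sum factors.\<close>
  also have "\<dots> = (\<Sum>(\<alpha>, \<beta>)\<in>?I \<times> ?I. F (\<alpha>, \<beta>))"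
    unfolding case_prod_eta
  proof (rule sum.mono_neutral_left)
    show "{(\<alpha>, \<beta>). \<alpha> + \<beta> \<in> ?I} \<subseteq> ?I \<times> ?I"
      by (auto simp: midx_def keys_add_nat mdeg_add)
    show "\<forall>x\<in>?I \<times> ?I - {(\<alpha>, \<beta>). \<alpha> + \<beta> \<in> ?I}. F x = 0"
    proof
      fix x assume "x \<in> ?I \<times> ?I - {(\<alpha>, \<beta>). \<alpha> + \<beta> \<in> ?I}"
      then obtain \<alpha> \<beta> where x: "x = (\<alpha>, \<beta>)" "\<alpha> \<in> ?I" "\<beta> \<in> ?I" "\<alpha> + \<beta> \<notin> ?I"
        by blast
      then have "fps_nth (mpower p (\<alpha> + \<beta>)) m = 0"
        using p by (intro nth_mpower_eq_0_mdeg) (auto simp: midx_def keys_add_nat)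
      then show "F x = 0" by (simp add: F_def x)
    qed
  qed auto
  also have "\<dots> = (\<Sum>\<alpha>\<in>?I. \<Sum>\<beta>\<in>?I. \<Sum>k=0..m.
      mps_coeff f \<alpha> * mps_coeff g \<beta> * (fps_nth (mpower p \<alpha>) k * fps_nth (mpower p \<beta>) (m - k)))"
    by (subst sum.cartesian_product[symmetric])
       (auto simp: F_def mpower_add fps_mult_nth sum_distrib_left intro!: sum.cong)
  also have "\<dots> = (\<Sum>\<alpha>\<in>?I. \<Sum>k=0..m. \<Sum>\<beta>\<in>?I.
      mps_coeff f \<alpha> * mps_coeff g \<beta> * (fps_nth (mpower p \<alpha>) k * fps_nth (mpower p \<beta>) (m - k)))"
    by (rule sum.cong[OF refl], rule sum.swap)
  also have "\<dots> = (\<Sum>k=0..m. \<Sum>\<alpha>\<in>?I. \<Sum>\<beta>\<in>?I.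
      mps_coeff f \<alpha> * mps_coeff g \<beta> * (fps_nth (mpower p \<alpha>) k * fps_nth (mpower p \<beta>) (m - k)))"
    by (rule sum.swap)
  also have "\<dots> = (\<Sum>k=0..m. (\<Sum>\<alpha>\<in>?I. mps_coeff f \<alpha> * fps_nth (mpower p \<alpha>) k) *
      (\<Sum>\<beta>\<in>?I. mps_coeff g \<beta> * fps_nth (mpower p \<beta>) (m - k)))"
    by (intro sum.cong refl) (simp add: sum_product algebra_simps)
  also have "\<dots> = fps_nth (mps_subst_fps f p * mps_subst_fps g p) m"
    unfolding fps_mult_nth
    by (intro sum.cong refl)
       (simp add: subst_fps_nth[OF f p, where d = m] subst_fps_nth[OF g p, where d = m])
  finally show "fps_nth (mps_subst_fps (f * g) p) m = fps_nth (mps_subst_fps f p * mps_subst_fps g p) m" .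
qed

lemma subst_fps_power:
  assumes f: "f \<in> mps_vars l" and p: "\<And>i. i < l \<Longrightarrow> fps_nth (p i) 0 = 0"
  shows "mps_subst_fps (f ^ k) p = mps_subst_fps f p ^ k"
proof (induction k)
  case (Suc k)
  then show ?case
    by (simp only: power_Suc subst_fps_mult[OF f mps_vars_power[OF f] p])
qed (simp add: subst_fps_1)

lemma subst_fps_prod:
  assumes f: "\<And>i. i \<in> A \<Longrightarrow> f i \<in> mps_vars l" and p: "\<And>i. i < l \<Longrightarrow> fps_nth (p i) 0 = 0"
  shows "mps_subst_fps (\<Prod>i\<in>A. f i) p = (\<Prod>i\<in>A. mps_subst_fps (f i) p)"
  using f
proof (induction A rule: infinite_finite_induct)
  case (insert x A)
  then have "mps_subst_fps (f x * (\<Prod>i\<in>A. f i)) p = mps_subst_fps (f x) p * mps_subst_fps (\<Prod>i\<in>A. f i) p"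
    by (intro subst_fps_mult[OF _ mps_vars_prod p]) auto
  with insert show ?case by simp
qed (simp_all add: subst_fps_1)

lemma subst_fps_mpower:
  assumes s: "\<And>i. i \<in> Poly_Mapping.keys \<alpha> \<Longrightarrow> s i \<in> mps_vars l"
    and p: "\<And>i. i < l \<Longrightarrow> fps_nth (p i) 0 = 0"
  shows "mps_subst_fps (mpower s \<alpha>) p = mpower (\<lambda>i. mps_subst_fps (s i) p) \<alpha>"
proof -
  have "mps_subst_fps (mpower s \<alpha>) p =
      (\<Prod>i\<in>Poly_Mapping.keys \<alpha>. mps_subst_fps (s i ^ Poly_Mapping.lookup \<alpha> i) p)"
    unfolding mpower_def by (rule subst_fps_prod[OF mps_vars_power p]) (rule s)
  also have "\<dots> = mpower (\<lambda>i. mps_subst_fps (s i) p) \<alpha>"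
    unfolding mpower_def by (rule prod.cong[OF refl]) (rule subst_fps_power[OF s p])
  finally show ?thesis .
qed

section \<open>Iterated substitution and the chain rule\<close>

lemma mps_vars_compose:
  assumes "f \<in> mps_vars l" "\<And>i. i < l \<Longrightarrow> s i \<in> mps_vars k" "\<And>i. i < l \<Longrightarrow> mps_coeff (s i) 0 = 0"
  shows "mps_compose f s \<in> mps_vars k"
  unfolding mps_vars_def
proof (intro CollectI allI impI)
  fix \<beta> assume "mps_coeff (mps_compose f s) \<beta> \<noteq> 0"
  then have "(\<Sum>\<alpha>\<in>midx l (mdeg \<beta>). mps_coeff f \<alpha> * mps_coeff (mpower s \<alpha>) \<beta>) \<noteq> 0"
    by (simp only: compose_coeff[OF assms(1,3) order_refl] not_False_eq_True)
  then obtain \<alpha> where \<alpha>: "\<alpha> \<in> midx l (mdeg \<beta>)" "mps_coeff (mpower s \<alpha>) \<beta> \<noteq> 0"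
    by (rule sum.not_neutral_contains_not_neutral) auto
  have "mpower s \<alpha> \<in> mps_vars k"
    using \<alpha>(1) assms(2) by (intro mps_vars_mpower) (auto simp: midx_def)
  then show "Poly_Mapping.keys \<beta> \<subseteq> {..<k}" using \<alpha>(2) by (rule mps_varsD)
qed

lemma subst_fps_nth_0:
  assumes "f \<in> mps_vars l" "\<And>i. i < l \<Longrightarrow> fps_nth (p i) 0 = 0"
  shows "fps_nth (mps_subst_fps f p) 0 = mps_coeff f 0"
proof -
  have "midx l 0 = {0}" by (auto simp: midx_def)
  moreover have "fps_nth (mps_subst_fps f p) 0 =
      (\<Sum>\<alpha>\<in>midx l 0. mps_coeff f \<alpha> * fps_nth (mpower p \<alpha>) 0)"
    by (rule subst_fps_nth[OF assms order_refl])
  ultimately show ?thesis by simp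
qed

text \<open>Coefficient \<open>m\<close> only involves monomials \<open>\<alpha>\<close> and
  \<open>\<beta>\<close> of degree at most \<open>m\<close>, so both inner sums can be cut off at
  the same bound and exchanged as finite sums. This allows the inverse of a diffeomorphism to be
  applied on a curve.\<close>

lemma subst_fps_compose:
  assumes f: "f \<in> mps_vars l" and s: "\<And>i. i < l \<Longrightarrow> s i \<in> mps_vars k"
    and s0: "\<And>i. i < l \<Longrightarrow> mps_coeff (s i) 0 = 0" and p: "\<And>i. i < k \<Longrightarrow> fps_nth (p i) 0 = 0"
  shows "mps_subst_fps (mps_compose f s) p = mps_subst_fps f (\<lambda>i. mps_subst_fps (s i) p)"
proof (rule fps_ext)
  fix m
  have sp: "fps_nth (mps_subst_fps (s i) p) 0 = 0" if "i < l" for i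
    using s[OF that] s0[OF that] p by (simp add: subst_fps_nth_0[where l = k])
  have "fps_nth (mps_subst_fps (mps_compose f s) p) m =
      (\<Sum>\<beta>\<in>midx k m. mps_coeff (mps_compose f s) \<beta> * fps_nth (mpower p \<beta>) m)"
    by (rule subst_fps_nth[OF mps_vars_compose[OF f s s0] p order_refl])
  also have "\<dots> = (\<Sum>\<beta>\<in>midx k m. \<Sum>\<alpha>\<in>midx l m.
      mps_coeff f \<alpha> * (mps_coeff (mpower s \<alpha>) \<beta> * fps_nth (mpower p \<beta>) m))"
    by (intro sum.cong refl)
       (simp add: compose_coeff[OF f s0, where d = m] midx_def sum_distrib_right mult.assoc)
  also have "\<dots> = (\<Sum>\<alpha>\<in>midx l m. \<Sum>\<beta>\<in>midx k m.
      mps_coeff f \<alpha> * (mps_coeff (mpower s \<alpha>) \<beta> * fps_nth (mpower p \<beta>) m))"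
    by (rule sum.swap)
  also have "\<dots> = (\<Sum>\<alpha>\<in>midx l m. mps_coeff f \<alpha> * fps_nth (mps_subst_fps (mpower s \<alpha>) p) m)"
    by (intro sum.cong refl, subst subst_fps_nth[OF mps_vars_mpower p order_refl])
       (auto simp: midx_def sum_distrib_left intro!: s)
  also have "\<dots> = (\<Sum>\<alpha>\<in>midx l m. mps_coeff f \<alpha> * fps_nth (mpower (\<lambda>i. mps_subst_fps (s i) p) \<alpha>) m)"
    by (intro sum.cong refl, subst subst_fps_mpower[OF s p]) (auto simp: midx_def)
  also have "\<dots> = fps_nth (mps_subst_fps f (\<lambda>i. mps_subst_fps (s i) p)) m"
    by (rule subst_fps_nth[OF f sp order_refl, symmetric])
  finally show "fps_nth (mps_subst_fps (mps_compose f s) p) m =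
    fps_nth (mps_subst_fps f (\<lambda>i. mps_subst_fps (s i) p)) m" .
qed

lemma subst_fps_fps_compose:
  assumes f: "f \<in> mps_vars l" and p: "\<And>i. i < l \<Longrightarrow> fps_nth (p i) 0 = 0" and t: "fps_nth t 0 = 0"
  shows "mps_subst_fps f (\<lambda>i. fps_compose (p i) t) = fps_compose (mps_subst_fps f p) t"
proof (rule fps_ext)
  fix m
  have pw: "mpower (\<lambda>i. fps_compose (p i) t) \<alpha> = fps_compose (mpower p \<alpha>) t" for \<alpha>
    by (simp add: mpower_def fps_compose_power[OF t] fps_compose_prod_distrib[OF t])
  have "fps_nth (mps_subst_fps f (\<lambda>i. fps_compose (p i) t)) m =
      (\<Sum>\<alpha>\<in>midx l m. mps_coeff f \<alpha> * fps_nth (fps_compose (mpower p \<alpha>) t) m)"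
    by (subst subst_fps_nth[OF f _ order_refl]) (auto simp: p pw)
  also have "\<dots> = (\<Sum>\<alpha>\<in>midx l m. \<Sum>j=0..m.
      mps_coeff f \<alpha> * fps_nth (mpower p \<alpha>) j * fps_nth (t ^ j) m)"
    by (simp add: fps_compose_nth sum_distrib_left mult.assoc)
  also have "\<dots> = (\<Sum>j=0..m. (\<Sum>\<alpha>\<in>midx l m. mps_coeff f \<alpha> * fps_nth (mpower p \<alpha>) j) * fps_nth (t ^ j) m)"
    by (subst sum.swap) (simp add: sum_distrib_right)
  also have "\<dots> = fps_nth (fps_compose (mps_subst_fps f p) t) m"
    unfolding fps_compose_nth
    by (intro sum.cong refl) (simp add: subst_fps_nth[OF f p, where d = m])
  finally show "fps_nth (mps_subst_fps f (\<lambda>i. fps_compose (p i) t)) m =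
    fps_nth (fps_compose (mps_subst_fps f p) t) m" .
qed

text \<open>The chain rule for Jacobian matrices at the origin: only monomials of degree at most
  \<open>1\<close> reach a linear coefficient, and the constant one contributes nothing to
  it.\<close>

lemma compose_coeff_evec:
  assumes "f \<in> mps_vars l" "\<And>i. i < l \<Longrightarrow> mps_coeff (s i) 0 = 0"
  shows "mps_coeff (mps_compose f s) (evec k) = (\<Sum>j<l. mps_coeff f (evec j) * mps_coeff (s j) (evec k))"
proof -
  have I: "midx l 1 = insert 0 (evec ` {..<l})"
  proof (intro Set.set_eqI iffI)
    fix \<alpha> assume \<alpha>: "\<alpha> \<in> midx l 1"
    then have "mdeg \<alpha> \<le> 1" by (simp add: midx_def)
    then have "mdeg \<alpha> = 0 \<or> mdeg \<alpha> = 1" by linarith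
    then show "\<alpha> \<in> insert 0 (evec ` {..<l})"
    proof
      assume "mdeg \<alpha> = 1"
      then obtain j where "\<alpha> = evec j" by (rule mdeg_1_imp_evec)
      then show ?thesis using \<alpha> by (auto simp: midx_def)
    qed simp
  qed (auto simp: midx_def)
  have "mps_coeff (mps_compose f s) (evec k) =
      (\<Sum>\<alpha>\<in>midx l 1. mps_coeff f \<alpha> * mps_coeff (mpower s \<alpha>) (evec k))"
    by (rule compose_coeff) (use assms in auto)
  also have "\<dots> = (\<Sum>\<alpha>\<in>evec ` {..<l}. mps_coeff f \<alpha> * mps_coeff (mpower s \<alpha>) (evec k))"
    unfolding I by (subst sum.insert) (auto simp: coeff_1)
  also have "\<dots> = (\<Sum>j<l. mps_coeff f (evec j) * mps_coeff (s j) (evec k))"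
    by (subst sum.reindex) (auto simp: inj_on_def)
  finally show ?thesis .
qed


section \<open>Convergence\<close>

text \<open>The weighted absolute sum of the coefficients at radius \<open>s\<close> is at most
  \<open>C\<close>. Bounding partial sums avoids presupposing summability.\<close>

definition fps_majorized :: "real \<Rightarrow> real \<Rightarrow> complex fps \<Rightarrow> bool" where
  "fps_majorized s C f \<longleftrightarrow> (\<forall>N. (\<Sum>k\<le>N. norm (fps_nth f k) * s ^ k) \<le> C)"

lemma fps_majorizedD: "fps_majorized s C f \<Longrightarrow> (\<Sum>k\<le>N. norm (fps_nth f k) * s ^ k) \<le> C"
  by (simp add: fps_majorized_def)

lemma fps_majorized_mult:
  assumes "s > 0" "fps_majorized s C f" "fps_majorized s D g"
  shows "fps_majorized s (C * D) (f * g)"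
  unfolding fps_majorized_def
proof
  fix N
  define a where "a = (\<lambda>k. norm (fps_nth f k) * s ^ k)"
  define b where "b = (\<lambda>k. norm (fps_nth g k) * s ^ k)"
  have nn: "a k \<ge> 0" "b k \<ge> 0" for k
    using assms(1) by (auto simp: a_def b_def)
  have "norm (fps_nth (f * g) k) * s ^ k \<le> (\<Sum>i\<le>k. a i * b (k - i))" for k
  proof -
    have "norm (fps_nth (f * g) k) \<le> (\<Sum>i=0..k. norm (fps_nth f i) * norm (fps_nth g (k - i)))"
      unfolding fps_mult_nth by (rule order_trans[OF norm_sum]) (simp add: norm_mult)
    then have "norm (fps_nth (f * g) k) * s ^ k
        \<le> (\<Sum>i=0..k. norm (fps_nth f i) * norm (fps_nth g (k - i))) * s ^ k"
      using assms(1) by (intro mult_right_mono) auto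
    also have "\<dots> = (\<Sum>i\<le>k. a i * b (k - i))"
      unfolding sum_distrib_right atMost_atLeast0
    proof (rule sum.cong[OF refl])
      fix i assume "i \<in> {0..k}"
      then have "s ^ k = s ^ i * s ^ (k - i)"
        by (simp flip: power_add)
      then show "norm (fps_nth f i) * norm (fps_nth g (k - i)) * s ^ k = a i * b (k - i)"
        by (simp add: a_def b_def)
    qed
    finally show ?thesis .
  qed
  then have "(\<Sum>k\<le>N. norm (fps_nth (f * g) k) * s ^ k) \<le> (\<Sum>k\<le>N. \<Sum>i\<le>k. a i * b (k - i))"
    by (rule sum_mono)
  also have "\<dots> = (\<Sum>(i, j)\<in>{(i, j). i + j \<le> N}. a i * b j)"
    by (rule sum.triangle_reindex_eq[symmetric])
  \<comment> \<open>The triangle lies in the square and all terms are nonnegative; the square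
    factors into two partial sums.\<close>
  also have "\<dots> \<le> (\<Sum>(i, j)\<in>{..N} \<times> {..N}. a i * b j)"
    using nn by (intro sum_mono2) auto
  also have "\<dots> = (\<Sum>i\<le>N. a i) * (\<Sum>j\<le>N. b j)"
    by (simp add: sum_product sum.cartesian_product)
  also have "\<dots> \<le> C * D"
  proof (rule mult_mono)
    show "sum a {..N} \<le> C" "sum b {..N} \<le> D"
      using assms(2,3) unfolding a_def b_def by (auto intro: fps_majorizedD)
    show "0 \<le> sum b {..N}" "0 \<le> C"
      using nn order_trans[OF sum_nonneg \<open>sum a {..N} \<le> C\<close>] by (auto intro: sum_nonneg)
  qed
  finally show "(\<Sum>k\<le>N. norm (fps_nth (f * g) k) * s ^ k) \<le> C * D" .
qed

lemma fps_majorized_1: "fps_majorized s 1 1"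
  by (simp add: fps_majorized_def sum.atMost_shift)

lemma fps_majorized_power:
  assumes "s > 0" "fps_majorized s C f"
  shows "fps_majorized s (C ^ k) (f ^ k)"
  by (induction k) (use assms in \<open>auto simp: fps_majorized_1 intro: fps_majorized_mult\<close>)

lemma fps_majorized_prod:
  assumes "s > 0" "\<And>i. i \<in> A \<Longrightarrow> fps_majorized s (C i) (f i)"
  shows "fps_majorized s (\<Prod>i\<in>A. C i) (\<Prod>i\<in>A. f i)"
  using assms(2)
  by (induction A rule: infinite_finite_induct)
     (auto simp: fps_majorized_1 intro: fps_majorized_mult assms(1))

lemma fps_majorized_mpower:
  assumes "s > 0" "\<And>i. i \<in> Poly_Mapping.keys \<alpha> \<Longrightarrow> fps_majorized s r (p i)"
  shows "fps_majorized s (r ^ mdeg \<alpha>) (mpower p \<alpha>)"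
  unfolding mpower_def mdeg_def power_sum
  using assms by (intro fps_majorized_prod fps_majorized_power) auto

lemma fps_majorized_imp_conv:
  assumes "s > 0" "fps_majorized s C f"
  shows "f \<in> conv_fps"
proof -
  have "summable (\<lambda>k. norm (fps_nth f k) * s ^ k)"
  proof (rule bounded_imp_summable)
    show "(\<Sum>k\<le>n. norm (fps_nth f k) * s ^ k) \<le> C" for n
      using assms(2) by (rule fps_majorizedD)
  qed (use assms(1) in auto)
  then have "summable (\<lambda>k. norm (fps_nth f k * of_real s ^ k))"
    using assms(1) by (simp add: norm_mult norm_power)
  then have "summable (\<lambda>k. fps_nth f k * of_real s ^ k)"
    by (rule summable_norm_cancel)
  then have "ereal (norm (of_real s :: complex)) \<le> fps_conv_radius f"
    unfolding fps_conv_radius_def by (rule conv_radius_geI)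
  then show ?thesis
    using assms(1) order.strict_trans2[of 0 "ereal s"] by (simp add: conv_fps_def)
qed

lemma conv_fps_majorized:
  assumes "f \<in> conv_fps"
  obtains s C where "s > 0" "fps_majorized s C f"
proof -
  from assms have "0 < fps_conv_radius f" by (simp add: conv_fps_def)
  then obtain s where s: "0 < ereal s" "ereal s < fps_conv_radius f"
    using ereal_dense2 by blast
  have "summable (\<lambda>k. norm (fps_nth f k * of_real s ^ k))"
    using s unfolding fps_conv_radius_def by (intro abs_summable_in_conv_radius) simp
  then have sm: "summable (\<lambda>k. norm (fps_nth f k) * s ^ k)"
    using s by (simp add: norm_mult norm_power)
  have "fps_majorized s (suminf (\<lambda>k. norm (fps_nth f k) * s ^ k)) f"
    unfolding fps_majorized_def using s by (intro allI sum_le_suminf sm) auto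
  then show thesis using that[of s] s by simp
qed

text \<open>Without constant term the absolute sum tends to \<open>0\<close> with the radius. The
  form with \<open>eventually\<close> lets finitely many components share one radius.\<close>

lemma eventually_fps_majorized:
  assumes "f \<in> conv_fps" "fps_nth f 0 = 0" "r > 0"
  shows "eventually (\<lambda>s. fps_majorized s r f) (at_right 0)"
proof -
  obtain s1 C where s1: "s1 > 0" "fps_majorized s1 C f"
    using conv_fps_majorized[OF assms(1)] .
  have C: "C \<ge> 0"
    using fps_majorizedD[OF s1(2), of 0] assms(2) by simp
  \<comment> \<open>The factor by which the radius \<open>s1\<close> shrinks. The bound
    \<open>1\<close> gives \<open>t ^ k \<le> t\<close> for \<open>k \<ge> 1\<close>, and adding
    \<open>1\<close> to \<open>C\<close> avoids division by zero.\<close>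
  define t where "t = min 1 (r / (C + 1))"
  have t: "0 < t" "t \<le> 1" "t * C \<le> r"
  proof -
    show "0 < t" "t \<le> 1" using C assms(3) by (auto simp: t_def)
    have "t * C \<le> r / (C + 1) * C"
      using C by (intro mult_right_mono) (auto simp: t_def)
    also have "\<dots> \<le> r" using C assms(3) by (simp add: field_simps)
    finally show "t * C \<le> r" .
  qed
  have "fps_majorized s r f" if s: "0 < s" "s < t * s1" for s
    unfolding fps_majorized_def
  proof
    fix N
    have "norm (fps_nth f k) * s ^ k \<le> t * (norm (fps_nth f k) * s1 ^ k)" for k
    proof (cases k)
      case (Suc j)
      have "s ^ k \<le> (t * s1) ^ k" using s by (intro power_mono) auto
      also have "\<dots> = t ^ k * s1 ^ k" by (rule power_mult_distrib)
      also have "\<dots> \<le> t * s1 ^ k"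
        using t s1 by (intro mult_right_mono) (auto simp: Suc power_le_one mult_le_cancel_left1)
      finally have "norm (fps_nth f k) * s ^ k \<le> norm (fps_nth f k) * (t * s1 ^ k)"
        by (rule mult_left_mono) simp
      then show ?thesis by (simp add: mult.left_commute)
    qed (simp add: assms(2))
    then have "(\<Sum>k\<le>N. norm (fps_nth f k) * s ^ k) \<le> t * (\<Sum>k\<le>N. norm (fps_nth f k) * s1 ^ k)"
      unfolding sum_distrib_left by (rule sum_mono)
    also have "\<dots> \<le> t * C"
      using t fps_majorizedD[OF s1(2)] by (intro mult_left_mono) auto
    also have "\<dots> \<le> r" by (rule t)
    finally show "(\<Sum>k\<le>N. norm (fps_nth f k) * s ^ k) \<le> r" .
  qed
  moreover have "0 < t * s1" using t s1 by simp
  ultimately show ?thesis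
    unfolding eventually_at_right_field by blast
qed

text \<open>At a radius where the absolute sum of \<open>g\<close> is at most \<open>r\<close>, that
  of \<open>g ^ j\<close> is at most \<open>r ^ j\<close>; a majorant of \<open>f\<close> at radius
  \<open>r\<close> therefore also bounds the composite.\<close>

lemma conv_fps_compose:
  assumes f: "f \<in> conv_fps" and g: "g \<in> conv_fps" "fps_nth g 0 = 0"
  shows "fps_compose f g \<in> conv_fps"
proof -
  obtain r C where r: "r > 0" "fps_majorized r C f"
    using conv_fps_majorized[OF f] .
  have "eventually (\<lambda>s. s > 0 \<and> fps_majorized s r g) (at_right 0)"
    by (intro eventually_conj eventually_at_right_less eventually_fps_majorized g r)
  then obtain s where s: "s > 0" "fps_majorized s r g"
    using eventually_happens'[OF trivial_limit_at_right_real] by blast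
  have "fps_majorized s C (fps_compose f g)"
    unfolding fps_majorized_def
  proof
    fix N
    have "norm (fps_nth (fps_compose f g) k) * s ^ k
        \<le> (\<Sum>j\<le>N. norm (fps_nth f j) * (norm (fps_nth (g ^ j) k) * s ^ k))" if "k \<le> N" for k
    proof -
      have "fps_nth (fps_compose f g) k = (\<Sum>j\<le>N. fps_nth f j * fps_nth (g ^ j) k)"
        unfolding fps_compose_nth using that startsby_zero_power_prefix[OF g(2)]
        by (intro sum.mono_neutral_left) auto
      then have "norm (fps_nth (fps_compose f g) k) \<le> (\<Sum>j\<le>N. norm (fps_nth f j) * norm (fps_nth (g ^ j) k))"
        by (metis (mono_tags, lifting) norm_mult norm_sum sum.cong)
      then have "norm (fps_nth (fps_compose f g) k) * s ^ k
          \<le> (\<Sum>j\<le>N. norm (fps_nth f j) * norm (fps_nth (g ^ j) k)) * s ^ k"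
        using s by (intro mult_right_mono) auto
      then show ?thesis by (simp add: sum_distrib_right mult.assoc)
    qed
    then have "(\<Sum>k\<le>N. norm (fps_nth (fps_compose f g) k) * s ^ k) \<le>
        (\<Sum>k\<le>N. \<Sum>j\<le>N. norm (fps_nth f j) * (norm (fps_nth (g ^ j) k) * s ^ k))"
      by (intro sum_mono) auto
    also have "\<dots> = (\<Sum>j\<le>N. norm (fps_nth f j) * (\<Sum>k\<le>N. norm (fps_nth (g ^ j) k) * s ^ k))"
      by (subst sum.swap) (simp add: sum_distrib_left)
    also have "\<dots> \<le> (\<Sum>j\<le>N. norm (fps_nth f j) * r ^ j)"
      by (intro sum_mono mult_left_mono fps_majorizedD fps_majorized_power s norm_ge_zero)
    also have "\<dots> \<le> C" using r(2) by (rule fps_majorizedD)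
    finally show "(\<Sum>k\<le>N. norm (fps_nth (fps_compose f g) k) * s ^ k) \<le> C" .
  qed
  then show ?thesis using s fps_majorized_imp_conv by blast
qed

text \<open>The analogue of composition in several variables: all components are made at most the
  polydisc radius \<open>r\<close> of \<open>f\<close> at a common radius \<open>s\<close>, so a
  monomial of degree \<open>d\<close> costs at most \<open>r ^ d\<close>.\<close>

lemma conv_fps_subst:
  assumes f: "f \<in> conv_mps l" and p: "\<And>i. i < l \<Longrightarrow> p i \<in> conv_fps" "\<And>i. i < l \<Longrightarrow> fps_nth (p i) 0 = 0"
  shows "mps_subst_fps f p \<in> conv_fps"
proof -
  obtain r where r: "r > 0" "(\<lambda>\<alpha>. norm (mps_coeff f \<alpha>) * r ^ mdeg \<alpha>) summable_on UNIV"
    using f by (auto simp: conv_mps_def)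
  have "eventually (\<lambda>s. s > 0 \<and> (\<forall>i\<in>{..<l}. fps_majorized s r (p i))) (at_right 0)"
    using p r by (intro eventually_conj eventually_at_right_less eventually_ball_finite ballI
      eventually_fps_majorized) auto
  then obtain s where s: "s > 0" "\<And>i. i < l \<Longrightarrow> fps_majorized s r (p i)"
    using eventually_happens'[OF trivial_limit_at_right_real] by blast
  define C where "C = (\<Sum>\<^sub>\<infinity>\<alpha>. norm (mps_coeff f \<alpha>) * r ^ mdeg \<alpha>)"
  have "fps_majorized s C (mps_subst_fps f p)"
    unfolding fps_majorized_def
  proof
    fix N
    have "norm (fps_nth (mps_subst_fps f p) k) * s ^ k
        \<le> (\<Sum>\<alpha>\<in>midx l N. norm (mps_coeff f \<alpha>) * (norm (fps_nth (mpower p \<alpha>) k) * s ^ k))"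
      if "k \<le> N" for k
    proof -
      have "fps_nth (mps_subst_fps f p) k = (\<Sum>\<alpha>\<in>midx l N. mps_coeff f \<alpha> * fps_nth (mpower p \<alpha>) k)"
        using conv_mps_vars[OF f] p(2) that by (rule subst_fps_nth)
      then have "norm (fps_nth (mps_subst_fps f p) k)
          \<le> (\<Sum>\<alpha>\<in>midx l N. norm (mps_coeff f \<alpha>) * norm (fps_nth (mpower p \<alpha>) k))"
        by (metis (mono_tags, lifting) norm_mult norm_sum sum.cong)
      then have "norm (fps_nth (mps_subst_fps f p) k) * s ^ k
          \<le> (\<Sum>\<alpha>\<in>midx l N. norm (mps_coeff f \<alpha>) * norm (fps_nth (mpower p \<alpha>) k)) * s ^ k"
        using s by (intro mult_right_mono) auto
      then show ?thesis by (simp add: sum_distrib_right mult.assoc)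
    qed
    then have "(\<Sum>k\<le>N. norm (fps_nth (mps_subst_fps f p) k) * s ^ k) \<le>
        (\<Sum>k\<le>N. \<Sum>\<alpha>\<in>midx l N. norm (mps_coeff f \<alpha>) * (norm (fps_nth (mpower p \<alpha>) k) * s ^ k))"
      by (intro sum_mono) auto
    also have "\<dots> = (\<Sum>\<alpha>\<in>midx l N. norm (mps_coeff f \<alpha>) * (\<Sum>k\<le>N. norm (fps_nth (mpower p \<alpha>) k) * s ^ k))"
      by (subst sum.swap) (simp add: sum_distrib_left)
    also have "\<dots> \<le> (\<Sum>\<alpha>\<in>midx l N. norm (mps_coeff f \<alpha>) * r ^ mdeg \<alpha>)"
      using s by (intro sum_mono mult_left_mono fps_majorizedD fps_majorized_mpower norm_ge_zero)
        (auto simp: midx_def)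
    also have "\<dots> \<le> C"
      unfolding C_def using r by (intro finite_sum_le_infsum) auto
    finally show "(\<Sum>k\<le>N. norm (fps_nth (mps_subst_fps f p) k) * s ^ k) \<le> C" .
  qed
  then show ?thesis using s fps_majorized_imp_conv by blast
qed


section \<open>The ring of convergent power series\<close>

text \<open>Any radius works for a polynomial. This supplies convergence for the truncations that
  witness membership in value sets.\<close>

lemma conv_mps_finite_support:
  assumes "f \<in> mps_vars l" "finite {\<alpha>. mps_coeff f \<alpha> \<noteq> 0}"
  shows "f \<in> conv_mps l"
proof -
  have "(\<lambda>\<alpha>. norm (mps_coeff f \<alpha>) * 1 ^ mdeg \<alpha>) summable_on {\<alpha>. mps_coeff f \<alpha> \<noteq> 0}"
    using assms(2) by (rule summable_on_finite)
  then have "(\<lambda>\<alpha>. norm (mps_coeff f \<alpha>) * 1 ^ mdeg \<alpha>) summable_on UNIV"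
    by (rule summable_on_cong_neutral[THEN iffD1, rotated -1]) auto
  then show ?thesis
    using assms(1) unfolding conv_mps_def mps_vars_def
    by (auto intro!: exI[of _ "1 :: real"])
qed

lemma conv_mps_var: "i < l \<Longrightarrow> mps_var i \<in> conv_mps l"
  by (rule conv_mps_finite_support)
     (auto simp: mps_vars_def coeff_var split: if_splits intro: finite_subset[of _ "{evec i}"])

lemma eventually_conv_mps_summable:
  assumes "f \<in> conv_mps l"
  shows "eventually (\<lambda>r. (\<lambda>\<alpha>. norm (mps_coeff f \<alpha>) * r ^ mdeg \<alpha>) summable_on UNIV) (at_right 0)"
proof -
  obtain r where r: "r > 0" "(\<lambda>\<alpha>. norm (mps_coeff f \<alpha>) * r ^ mdeg \<alpha>) summable_on UNIV"
    using assms by (auto simp: conv_mps_def)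
  have "(\<lambda>\<alpha>. norm (mps_coeff f \<alpha>) * s ^ mdeg \<alpha>) summable_on UNIV" if "0 < s" "s < r" for s
    by (rule summable_on_comparison_test[OF r(2)])
       (use that in \<open>auto intro!: mult_left_mono power_mono\<close>)
  then show ?thesis
    unfolding eventually_at_right_field using r(1) by blast
qed

lemma conv_mps_common_radius:
  assumes "f \<in> conv_mps l" "g \<in> conv_mps l"
  obtains r where "r > 0" "(\<lambda>\<alpha>. norm (mps_coeff f \<alpha>) * r ^ mdeg \<alpha>) summable_on UNIV"
    "(\<lambda>\<alpha>. norm (mps_coeff g \<alpha>) * r ^ mdeg \<alpha>) summable_on UNIV"
proof -
  have "eventually (\<lambda>r. r > 0 \<and> (\<lambda>\<alpha>. norm (mps_coeff f \<alpha>) * r ^ mdeg \<alpha>) summable_on UNIV \<and>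
      (\<lambda>\<alpha>. norm (mps_coeff g \<alpha>) * r ^ mdeg \<alpha>) summable_on UNIV) (at_right 0)"
    by (intro eventually_conj eventually_at_right_less eventually_conv_mps_summable[OF assms(1)]
        eventually_conv_mps_summable[OF assms(2)])
  then show thesis
    using eventually_happens'[OF trivial_limit_at_right_real] that by blast
qed

lemma conv_mps_add:
  assumes "f \<in> conv_mps l" "g \<in> conv_mps l"
  shows "f + g \<in> conv_mps l"
proof -
  obtain r where r: "r > 0" "(\<lambda>\<alpha>. norm (mps_coeff f \<alpha>) * r ^ mdeg \<alpha>) summable_on UNIV"
    "(\<lambda>\<alpha>. norm (mps_coeff g \<alpha>) * r ^ mdeg \<alpha>) summable_on UNIV"
    using conv_mps_common_radius[OF assms] .
  have "(\<lambda>\<alpha>. norm (mps_coeff (f + g) \<alpha>) * r ^ mdeg \<alpha>) summable_on UNIV"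
    by (rule summable_on_comparison_test[OF summable_on_add[OF r(2,3)]])
       (use r(1) in \<open>auto simp: norm_triangle_ineq mult_right_mono simp flip: distrib_right\<close>)
  moreover have "Poly_Mapping.keys \<alpha> \<subseteq> {..<l}" if "mps_coeff (f + g) \<alpha> \<noteq> 0" for \<alpha>
  proof -
    from that have "mps_coeff f \<alpha> \<noteq> 0 \<or> mps_coeff g \<alpha> \<noteq> 0" by auto
    then show ?thesis
      using mps_varsD[OF conv_mps_vars] assms by blast
  qed
  ultimately show ?thesis using r(1) unfolding conv_mps_def by blast
qed

lemma conv_mps_const_mult:
  assumes "f \<in> conv_mps l"
  shows "mps_const c * f \<in> conv_mps l"
proof -
  obtain r where r: "r > 0" "(\<lambda>\<alpha>. norm (mps_coeff f \<alpha>) * r ^ mdeg \<alpha>) summable_on UNIV"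
    using conv_mps_common_radius[OF assms assms] .
  have "(\<lambda>\<alpha>. norm (mps_coeff (mps_const c * f) \<alpha>) * r ^ mdeg \<alpha>) summable_on UNIV"
    using summable_on_cmult_right[OF r(2), of "norm c"] by (simp add: norm_mult mult.assoc)
  then show ?thesis
    using r(1) mps_vars_const_mult[OF conv_mps_vars[OF assms], of c]
    unfolding conv_mps_def mps_vars_def by blast
qed

lemma conv_mps_uminus: "f \<in> conv_mps l \<Longrightarrow> - f \<in> conv_mps l"
  by (simp add: conv_mps_def)

lemma conv_mps_diff: "f \<in> conv_mps l \<Longrightarrow> g \<in> conv_mps l \<Longrightarrow> f - g \<in> conv_mps l"
  using conv_mps_add[OF _ conv_mps_uminus, of f l g] by simp

text \<open>All terms are nonnegative, so it suffices to bound every finite partial sum by the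
  product of the two absolute sums.\<close>

lemma conv_mps_mult:
  assumes "f \<in> conv_mps l" "g \<in> conv_mps l"
  shows "f * g \<in> conv_mps l"
proof -
  obtain r where r: "r > 0" "(\<lambda>\<alpha>. norm (mps_coeff f \<alpha>) * r ^ mdeg \<alpha>) summable_on UNIV"
    "(\<lambda>\<alpha>. norm (mps_coeff g \<alpha>) * r ^ mdeg \<alpha>) summable_on UNIV"
    using conv_mps_common_radius[OF assms] .
  define a where "a = (\<lambda>\<alpha>. norm (mps_coeff f \<alpha>) * r ^ mdeg \<alpha>)"
  define b where "b = (\<lambda>\<alpha>. norm (mps_coeff g \<alpha>) * r ^ mdeg \<alpha>)"
  have nn: "a \<alpha> \<ge> 0" "b \<alpha> \<ge> 0" for \<alpha> using r(1) by (auto simp: a_def b_def)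
  have "(\<lambda>\<gamma>. norm (mps_coeff (f * g) \<gamma>) * r ^ mdeg \<gamma>) summable_on UNIV"
  proof (rule nonneg_bdd_above_summable_on)
    show "bdd_above (sum (\<lambda>\<gamma>. norm (mps_coeff (f * g) \<gamma>) * r ^ mdeg \<gamma>) ` {F. F \<subseteq> UNIV \<and> finite F})"
    proof (rule bdd_aboveI2)
      fix G :: "mindex set" assume "G \<in> {F. F \<subseteq> UNIV \<and> finite F}"
      then have fin: "finite G" by simp
      define S where "S = (\<Union>\<gamma>\<in>G. splits \<gamma>)"
      have finS: "finite S" using fin by (simp add: S_def)
      have "norm (mps_coeff (f * g) \<gamma>) * r ^ mdeg \<gamma> \<le> (\<Sum>(\<alpha>, \<beta>)\<in>splits \<gamma>. a \<alpha> * b \<beta>)" for \<gamma>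
      proof -
        have "norm (mps_coeff (f * g) \<gamma>)
            \<le> (\<Sum>(\<alpha>, \<beta>)\<in>splits \<gamma>. norm (mps_coeff f \<alpha>) * norm (mps_coeff g \<beta>))"
          unfolding coeff_mult by (rule order_trans[OF norm_sum]) (simp add: case_prod_unfold norm_mult)
        then have "norm (mps_coeff (f * g) \<gamma>) * r ^ mdeg \<gamma>
            \<le> (\<Sum>(\<alpha>, \<beta>)\<in>splits \<gamma>. norm (mps_coeff f \<alpha>) * norm (mps_coeff g \<beta>)) * r ^ mdeg \<gamma>"
          using r(1) by (intro mult_right_mono) auto
        also have "\<dots> = (\<Sum>(\<alpha>, \<beta>)\<in>splits \<gamma>. a \<alpha> * b \<beta>)"
          unfolding sum_distrib_right
          by (intro sum.cong refl) (auto simp: splits_def a_def b_def mdeg_add power_add)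
        finally show ?thesis .
      qed
      then have "(\<Sum>\<gamma>\<in>G. norm (mps_coeff (f * g) \<gamma>) * r ^ mdeg \<gamma>)
          \<le> (\<Sum>\<gamma>\<in>G. \<Sum>(\<alpha>, \<beta>)\<in>splits \<gamma>. a \<alpha> * b \<beta>)"
        by (rule sum_mono)
      also have "\<dots> = (\<Sum>(\<alpha>, \<beta>)\<in>S. a \<alpha> * b \<beta>)"
        unfolding S_def
      proof (rule sum.UNION_disjoint[symmetric])
        show "\<forall>i\<in>G. \<forall>j\<in>G. i \<noteq> j \<longrightarrow> splits i \<inter> splits j = {}"
          by (auto simp: splits_def)
      qed (simp_all add: fin)
      \<comment> \<open>The finite set of pairs is enlarged to the product of its projections, over
        which the sum factors.\<close>
      also have "\<dots> \<le> (\<Sum>(\<alpha>, \<beta>)\<in>fst ` S \<times> snd ` S. a \<alpha> * b \<beta>)"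
        using nn finS by (intro sum_mono2) (force intro: mult_nonneg_nonneg)+
      also have "\<dots> = (\<Sum>\<alpha>\<in>fst ` S. a \<alpha>) * (\<Sum>\<beta>\<in>snd ` S. b \<beta>)"
        by (simp add: sum_product sum.cartesian_product)
      also have "\<dots> \<le> (\<Sum>\<^sub>\<infinity>\<alpha>. a \<alpha>) * (\<Sum>\<^sub>\<infinity>\<beta>. b \<beta>)"
        using nn finS r(2,3) unfolding a_def[symmetric] b_def[symmetric]
        by (intro mult_mono finite_sum_le_infsum) (auto intro!: infsum_nonneg sum_nonneg)
      finally show "(\<Sum>\<gamma>\<in>G. norm (mps_coeff (f * g) \<gamma>) * r ^ mdeg \<gamma>)
          \<le> (\<Sum>\<^sub>\<infinity>\<alpha>. a \<alpha>) * (\<Sum>\<^sub>\<infinity>\<beta>. b \<beta>)" .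
    qed
  qed (use r(1) in auto)
  then show ?thesis
    using r(1) mps_vars_mult[OF conv_mps_vars[OF assms(1)] conv_mps_vars[OF assms(2)]]
    unfolding conv_mps_def mps_vars_def by blast
qed

lemma conv_mps_0 [simp]: "0 \<in> conv_mps l"
  by (rule conv_mps_finite_support) (auto simp: mps_vars_def)

lemma conv_mps_1 [simp]: "1 \<in> conv_mps l"
  by (rule conv_mps_finite_support) (auto simp: coeff_1)

lemma conv_ring_simps [simp]:
  "carrier (conv_ring l) = conv_mps l" "mult (conv_ring l) = (*)" "one (conv_ring l) = 1"
  "zero (conv_ring l) = 0" "add (conv_ring l) = (+)"
  by (simp_all add: conv_ring_def)

lemma cring_conv_ring: "cring (conv_ring l)"
proof (intro cringI abelian_groupI comm_monoidI)
  fix x assume "x \<in> carrier (conv_ring l)"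
  then show "\<exists>y\<in>carrier (conv_ring l). y \<oplus>\<^bsub>conv_ring l\<^esub> x = \<zero>\<^bsub>conv_ring l\<^esub>"
    by (intro bexI[of _ "- x"]) (auto simp: conv_mps_uminus)
qed (auto simp: conv_mps_add conv_mps_mult algebra_simps)

lemma ring_conv_ring: "ring (conv_ring l)"
  using cring_conv_ring by (simp add: cring_def)

section \<open>Ideals described by low-degree coefficients\<close>

lemma conv_ring_ideal_sum:
  assumes "ideal I (conv_ring l)" "\<And>j. j \<in> A \<Longrightarrow> f j \<in> I"
  shows "(\<Sum>j\<in>A. f j) \<in> I"
proof -
  have sub: "additive_subgroup I (conv_ring l)"
    using assms(1) by (rule ideal.axioms(1))
  show ?thesis
    using assms(2)
    by (induction A rule: infinite_finite_induct)
       (use additive_subgroup.zero_closed[OF sub] additive_subgroup.a_closed[OF sub] in auto)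
qed

text \<open>Closed under multiplication by the product rule at the origin. As an ideal containing
  the relevant variables it bounds generated ideals from above: \<open>k = 0\<close> for the maximal
  ideal, \<open>k + 1\<close> for the ideal of the variables after \<open>Y\<^sub>k\<close>.\<close>

lemma ideal_low_coeffs_zero:
  "ideal {f \<in> conv_mps l. mps_coeff f 0 = 0 \<and> (\<forall>i<k. mps_coeff f (evec i) = 0)} (conv_ring l)"
  (is "ideal ?I _")
proof (rule idealI[OF ring_conv_ring])
  interpret cring "conv_ring l" by (rule cring_conv_ring)
  have inv: "inv\<^bsub>add_monoid (conv_ring l)\<^esub> x = - x" if "x \<in> conv_mps l" for x
  proof -
    have "\<ominus>\<^bsub>conv_ring l\<^esub> x = - x"
      using minus_equality[of "- x" x] that conv_mps_uminus by auto
    then show ?thesis by (simp add: a_inv_def)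
  qed
  show "subgroup ?I (add_monoid (conv_ring l))"
  proof (rule subgroup.intro)
    fix x assume x: "x \<in> ?I"
    then show "inv\<^bsub>add_monoid (conv_ring l)\<^esub> x \<in> ?I"
      by (subst inv) (auto simp: conv_mps_uminus)
  qed (auto simp: conv_mps_add)
qed (auto simp: conv_mps_mult coeff_mult_0 coeff_mult_evec)

lemma max_ideal_coeff_0:
  assumes "f \<in> max_ideal l"
  shows "f \<in> conv_mps l" "mps_coeff f 0 = 0"
proof -
  have "max_ideal l \<subseteq> {f \<in> conv_mps l. mps_coeff f 0 = 0 \<and> (\<forall>i<0. mps_coeff f (evec i) = 0)}"
    unfolding max_ideal_def
    by (rule ring.genideal_minimal[OF ring_conv_ring ideal_low_coeffs_zero])
       (auto simp: conv_mps_var coeff_var)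
  then show "f \<in> conv_mps l" "mps_coeff f 0 = 0" using assms by auto
qed

lemma ideal_max_ideal: "ideal (max_ideal l) (conv_ring l)"
  unfolding max_ideal_def
  by (rule ring.genideal_ideal[OF ring_conv_ring]) (auto simp: conv_mps_var)

lemma max_ideal_squared_coeffs:
  assumes "f \<in> max_ideal l \<cdot>\<^bsub>conv_ring l\<^esub> max_ideal l"
  shows "f \<in> conv_mps l \<and> mps_coeff f 0 = 0 \<and> mps_coeff f (evec i) = 0"
  using assms
  by induction (auto simp: conv_mps_mult conv_mps_add coeff_mult_0 coeff_mult_evec max_ideal_coeff_0)

text \<open>A convergent form of Hadamard's lemma. Each nonconstant monomial is charged to its
  variable of least index, so every coefficient of \<open>f\<close> is used once. The coefficients
  of \<open>q j\<close> are zero or shifted coefficients of \<open>f\<close>, which changes the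
  absolute sum by at most the factor \<open>1 / r\<close>.\<close>

lemma conv_mps_divide_vars:
  assumes f: "f \<in> conv_mps l" and f0: "mps_coeff f 0 = 0"
  obtains q where "\<And>j. q j \<in> conv_mps l" "\<And>j. mps_coeff (q j) 0 = mps_coeff f (evec j)"
    "f = (\<Sum>j<l. mps_var j * q j)"
proof
  define q where "q = (\<lambda>j. Abs_mps (\<lambda>\<beta>.
    if Min (Poly_Mapping.keys (\<beta> + evec j)) = j then mps_coeff f (\<beta> + evec j) else 0))"
  have q: "mps_coeff (q j) \<beta> =
      (if Min (Poly_Mapping.keys (\<beta> + evec j)) = j then mps_coeff f (\<beta> + evec j) else 0)" for j \<beta>
    by (simp add: q_def Abs_mps_inverse)
  show "mps_coeff (q j) 0 = mps_coeff f (evec j)" for j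
    by (simp add: q)
  show "q j \<in> conv_mps l" for j
  proof -
    obtain r where r: "r > 0" "(\<lambda>\<alpha>. norm (mps_coeff f \<alpha>) * r ^ mdeg \<alpha>) summable_on UNIV"
      using conv_mps_common_radius[OF f f] .
    have "(\<lambda>\<alpha>. norm (mps_coeff f \<alpha>) * r ^ mdeg \<alpha>) summable_on range (\<lambda>\<beta>. \<beta> + evec j)"
      using r(2) by (rule summable_on_subset_banach) simp
    then have "(\<lambda>\<beta>. norm (mps_coeff f (\<beta> + evec j)) * r ^ mdeg (\<beta> + evec j)) summable_on UNIV"
      by (subst (asm) summable_on_reindex) (auto simp: inj_on_def o_def)
    then have "(\<lambda>\<beta>. norm (mps_coeff f (\<beta> + evec j)) * r ^ mdeg (\<beta> + evec j) * inverse r) summable_on UNIV"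
      by (rule summable_on_cmult_left)
    moreover have "r ^ mdeg (\<beta> + evec j) * inverse r = r ^ mdeg \<beta>" for \<beta>
      using r(1) by (simp add: mdeg_add)
    ultimately have "(\<lambda>\<beta>. norm (mps_coeff f (\<beta> + evec j)) * r ^ mdeg \<beta>) summable_on UNIV"
      by (simp only: mult.assoc)
    then have "(\<lambda>\<beta>. norm (mps_coeff (q j) \<beta>) * r ^ mdeg \<beta>) summable_on UNIV"
      by (rule summable_on_comparison_test) (use r(1) in \<open>auto simp: q\<close>)
    moreover have "Poly_Mapping.keys \<beta> \<subseteq> {..<l}" if "mps_coeff (q j) \<beta> \<noteq> 0" for \<beta>
      using that mps_varsD[OF conv_mps_vars[OF f], of "\<beta> + evec j"]
      by (auto simp: q keys_add_nat split: if_splits)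
    ultimately show ?thesis using r(1) unfolding conv_mps_def by blast
  qed
  show "f = (\<Sum>j<l. mps_var j * q j)"
  proof (rule mps_eqI)
    fix \<gamma>
    have eq: "mps_coeff (mps_var j * q j) \<gamma> =
        (if j = Min (Poly_Mapping.keys \<gamma>) then mps_coeff f \<gamma> else 0)" if "\<gamma> \<noteq> 0" for j
    proof (cases "j \<in> Poly_Mapping.keys \<gamma>")
      case True
      then obtain \<beta> where "\<gamma> = evec j + \<beta>" by (rule mindex_split_var)
      then show ?thesis
        using True by (simp add: coeff_var_mult q add.commute)
    next
      case False
      moreover have "Min (Poly_Mapping.keys \<gamma>) \<in> Poly_Mapping.keys \<gamma>"
        using that by (intro Min_in) auto
      ultimately show ?thesis by (auto simp: coeff_var_mult)
    qed
    show "mps_coeff f \<gamma> = mps_coeff (\<Sum>j<l. mps_var j * q j) \<gamma>"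
    proof (cases "\<gamma> = 0")
      case False
      then have "Min (Poly_Mapping.keys \<gamma>) \<in> Poly_Mapping.keys \<gamma>"
        by (intro Min_in) auto
      then have "Min (Poly_Mapping.keys \<gamma>) < l" if "mps_coeff f \<gamma> \<noteq> 0"
        using mps_varsD[OF conv_mps_vars[OF f] that] by auto
      then show ?thesis
        using False by (cases "mps_coeff f \<gamma> = 0") (simp_all add: eq)
    qed (simp add: f0 coeff_var_mult)
  qed
qed

lemma in_max_ideal:
  assumes "f \<in> conv_mps l" "mps_coeff f 0 = 0"
  shows "f \<in> max_ideal l"
proof -
  obtain q where q: "\<And>j. q j \<in> conv_mps l" "f = (\<Sum>j<l. mps_var j * q j)"
    using conv_mps_divide_vars[OF assms] by metis
  have "mps_var j * q j \<in> max_ideal l" if "j < l" for j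
  proof -
    have "mps_var j \<in> max_ideal l"
      unfolding max_ideal_def
      using ring.genideal_self[OF ring_conv_ring, of "mps_var ` {..<l}" l] that
      by (auto simp: conv_mps_var image_subset_iff)
    then show ?thesis
      using ideal.I_r_closed[OF ideal_max_ideal _ , of "mps_var j" l "q j"] q(1) by simp
  qed
  then show ?thesis
    unfolding q(2) by (intro conv_ring_ideal_sum[OF ideal_max_ideal]) auto
qed

text \<open>In the decomposition of \<open>h\<close> by variables, the terms with
  \<open>j > k\<close> lie in the first ideal. For \<open>j \<le> k\<close> the quotient
  \<open>q j\<close> has constant term \<open>mps_coeff h (evec j) = 0\<close>, so
  \<open>mps_var j * q j\<close> is a product of two elements of the maximal ideal. For
  \<open>k = n\<close> the first ideal is generated by the empty set.\<close>

lemma tail_ideal_iff: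
  assumes "k \<le> n"
  shows "h \<in> Idl\<^bsub>conv_ring (n + 1)\<^esub> (mps_var ` {k + 1..n})
      <+>\<^bsub>conv_ring (n + 1)\<^esub> (max_ideal (n + 1) \<cdot>\<^bsub>conv_ring (n + 1)\<^esub> max_ideal (n + 1)) \<longleftrightarrow>
    h \<in> conv_mps (n + 1) \<and> mps_coeff h 0 = 0 \<and> (\<forall>i\<le>k. mps_coeff h (evec i) = 0)"
    (is "h \<in> ?J <+>\<^bsub>?R\<^esub> ?Q \<longleftrightarrow> ?rhs")
proof
  assume "h \<in> ?J <+>\<^bsub>?R\<^esub> ?Q"
  then obtain a b where ab: "a \<in> ?J" "b \<in> ?Q" "h = a + b"
    by (auto simp: set_add_def set_mult_def)
  have "?J \<subseteq> {f \<in> conv_mps (n + 1). mps_coeff f 0 = 0 \<and> (\<forall>i<k + 1. mps_coeff f (evec i) = 0)}"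
    by (rule ring.genideal_minimal[OF ring_conv_ring ideal_low_coeffs_zero])
       (auto simp: conv_mps_var coeff_var)
  then show ?rhs
    using ab max_ideal_squared_coeffs[OF ab(2)] conv_mps_add by auto
next
  assume h: ?rhs
  obtain q where q: "\<And>j. q j \<in> conv_mps (n + 1)" "\<And>j. mps_coeff (q j) 0 = mps_coeff h (evec j)"
    "h = (\<Sum>j<n + 1. mps_var j * q j)"
    using conv_mps_divide_vars[of h "n + 1"] h by metis
  have idJ: "ideal ?J ?R"
    by (rule ring.genideal_ideal[OF ring_conv_ring]) (auto simp: conv_mps_var)
  have idQ: "ideal ?Q ?R"
    by (intro ring.ideal_prod_is_ideal ring_conv_ring ideal_max_ideal)
  have "mps_var j * q j \<in> ?J" if "j \<in> {k + 1..n}" for j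
  proof -
    have "mps_var j \<in> ?J"
      using ring.genideal_self[OF ring_conv_ring, of "mps_var ` {k + 1..n}" "n + 1"] that
      by (auto simp: conv_mps_var image_subset_iff)
    then show ?thesis
      using ideal.I_r_closed[OF idJ _ , of "mps_var j" "q j"] q(1) by simp
  qed
  then have 1: "(\<Sum>j\<in>{k + 1..n}. mps_var j * q j) \<in> ?J"
    by (rule conv_ring_ideal_sum[OF idJ])
  have "mps_var j * q j \<in> ?Q" if "j \<in> {..k}" for j
  proof -
    have "mps_var j \<in> max_ideal (n + 1)" "q j \<in> max_ideal (n + 1)"
      using that assms h q(1,2) by (auto intro!: in_max_ideal conv_mps_var simp: coeff_var)
    then show ?thesis
      using ideal_prod.prod[of "mps_var j" "max_ideal (n + 1)" "q j" "max_ideal (n + 1)" ?R] by simp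
  qed
  then have 2: "(\<Sum>j\<in>{..k}. mps_var j * q j) \<in> ?Q"
    by (rule conv_ring_ideal_sum[OF idQ])
  have "{..<n + 1} = {k + 1..n} \<union> {..k}" using assms by auto
  then have "h = (\<Sum>j\<in>{k + 1..n}. mps_var j * q j) + (\<Sum>j\<in>{..k}. mps_var j * q j)"
    unfolding q(3) by (simp only:) (rule sum.union_disjoint; auto)
  then show "h \<in> ?J <+>\<^bsub>?R\<^esub> ?Q"
    using 1 2 by (auto simp: set_add_def set_mult_def)
qed


section \<open>Orders and germs of diffeomorphisms\<close>

text \<open>The coefficient form treats the zero series, of order \<open>\<infinity>\<close>, like
  every other series.\<close>

lemma fps_ord_gt_iff: "enat k < fps_ord f \<longleftrightarrow> (\<forall>m\<le>k. fps_nth f m = 0)"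
proof (cases "f = 0")
  case False
  have "k < subdegree f \<longleftrightarrow> (\<forall>m\<le>k. fps_nth f m = 0)"
    using False by (auto intro: subdegree_greaterI nth_less_subdegree_zero)
  then show ?thesis using False by (simp add: fps_ord_def)
qed (simp add: fps_ord_def)

lemma fps_ord_ge_2_iff: "2 \<le> fps_ord f \<longleftrightarrow> fps_nth f 0 = 0 \<and> fps_nth f 1 = 0"
proof -
  have "2 \<le> fps_ord f \<longleftrightarrow> enat 1 < fps_ord f"
    by (cases "fps_ord f") (auto simp: numeral_eq_enat)
  also have "\<dots> \<longleftrightarrow> fps_nth f 0 = 0 \<and> fps_nth f 1 = 0"
    unfolding fps_ord_gt_iff by (auto simp: le_Suc_eq)
  finally show ?thesis .
qed

text \<open>A substitution without constant term sends the lowest term of \<open>f\<close> to itself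
  times a power of the derivative of \<open>g\<close>. This is the source of the factors
  \<open>\<epsilon> ^ w k\<close>.\<close>

lemma fps_compose_leading:
  fixes f g :: "complex fps"
  assumes "fps_nth g 0 = 0" "\<And>m. m < k \<Longrightarrow> fps_nth f m = 0"
  shows "m < k \<Longrightarrow> fps_nth (fps_compose f g) m = 0"
    and "fps_nth (fps_compose f g) k = fps_nth f k * fps_nth g 1 ^ k"
proof -
  show "fps_nth (fps_compose f g) m = 0" if "m < k"
    unfolding fps_compose_nth using that assms(2) by (intro sum.neutral) auto
  have "fps_nth (fps_compose f g) k = (\<Sum>i\<in>{k}. fps_nth f i * fps_nth (g ^ i) k)"
    unfolding fps_compose_nth using assms(2) by (intro sum.mono_neutral_right) auto
  then show "fps_nth (fps_compose f g) k = fps_nth f k * fps_nth g 1 ^ k"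
    by (simp add: startsby_zero_power_nth_same[OF assms(1)])
qed

text \<open>\<open>fps_inv\<close> is a formal construction; its convergence follows because it must
  coincide with the convergent inverse that membership in \<open>diff1\<close> provides.\<close>

lemma diff1D:
  assumes "\<rho> \<in> diff1"
  shows "\<rho> \<in> conv_fps" "fps_nth \<rho> 0 = 0" "fps_nth \<rho> 1 \<noteq> 0"
    "fps_inv \<rho> \<in> conv_fps" "fps_nth (fps_inv \<rho>) 0 = 0" "fps_nth (fps_inv \<rho>) 1 = inverse (fps_nth \<rho> 1)"
    "fps_compose \<rho> (fps_inv \<rho>) = fps_X" "fps_compose (fps_inv \<rho>) \<rho> = fps_X"
proof -
  obtain \<tau> where \<tau>: "\<tau> \<in> conv_fps" "fps_nth \<tau> 0 = 0" "fps_compose \<rho> \<tau> = fps_X"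
    and \<rho>: "\<rho> \<in> conv_fps" "fps_nth \<rho> 0 = 0"
    using assms by (auto simp: diff1_def)
  have "fps_nth (fps_compose \<rho> \<tau>) 1 = fps_nth \<rho> 1 * fps_nth \<tau> 1"
    using fps_compose_leading(2)[OF \<tau>(2), of 1 \<rho>] \<rho>(2) by simp
  then have 1: "fps_nth \<rho> 1 * fps_nth \<tau> 1 = 1" by (simp add: \<tau>(3))
  then show \<rho>1: "fps_nth \<rho> 1 \<noteq> 0" by auto
  note inv = fps_inv[OF \<rho>(2) \<rho>1]
  have "fps_inv \<rho> = fps_compose (fps_inv \<rho>) (fps_compose \<rho> \<tau>)"
    by (simp add: \<tau>(3))
  \<comment> \<open>A left inverse and a right inverse of \<open>\<rho>\<close> agree by
    associativity.\<close>
  also have "\<dots> = \<tau>"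
    unfolding fps_compose_assoc[OF \<tau>(2) \<rho>(2)] inv using \<tau>(2) by simp
  finally have eq: "fps_inv \<rho> = \<tau>" .
  show "\<rho> \<in> conv_fps" "fps_nth \<rho> 0 = 0" "fps_compose (fps_inv \<rho>) \<rho> = fps_X"
    by (fact \<rho> inv)+
  show "fps_inv \<rho> \<in> conv_fps" "fps_nth (fps_inv \<rho>) 0 = 0" "fps_compose \<rho> (fps_inv \<rho>) = fps_X"
    by (simp_all add: eq \<tau>)
  show "fps_nth (fps_inv \<rho>) 1 = inverse (fps_nth \<rho> 1)"
    unfolding eq using 1 by (metis inverse_unique)
qed

lemma fps_compose_inv_cancel:
  assumes "\<rho> \<in> diff1"
  shows "fps_compose (fps_compose f (fps_inv \<rho>)) \<rho> = f" "fps_compose (fps_compose f \<rho>) (fps_inv \<rho>) = f"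
proof -
  note \<rho> = diff1D[OF assms]
  show "fps_compose (fps_compose f (fps_inv \<rho>)) \<rho> = f"
    unfolding fps_compose_assoc[OF \<rho>(2,5), symmetric] \<rho>(8) by simp
  show "fps_compose (fps_compose f \<rho>) (fps_inv \<rho>) = f"
    unfolding fps_compose_assoc[OF \<rho>(5,2), symmetric] \<rho>(7) by simp
qed

lemma map_germsD:
  assumes "\<sigma> \<in> map_germs l" "i < l"
  shows "\<sigma> i \<in> conv_mps l" "\<sigma> i \<in> mps_vars l" "mps_coeff (\<sigma> i) 0 = 0"
  using assms conv_mps_vars by (auto simp: map_germs_def)

text \<open>A zero row in the Jacobian of \<open>\<sigma>\<close> would, by the chain rule, make the
  diagonal entry of the identity vanish.\<close>

lemma diffs_linear_part:
  assumes "\<sigma> \<in> diffs l" "i < l"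
  obtains j where "j < l" "mps_coeff (\<sigma> i) (evec j) \<noteq> 0"
proof -
  obtain \<tau> where \<sigma>: "\<sigma> \<in> map_germs l" and \<tau>: "\<tau> \<in> map_germs l" "mps_compose (\<sigma> i) \<tau> = mps_var i"
    using assms by (auto simp: diffs_def)
  have "(\<Sum>j<l. mps_coeff (\<sigma> i) (evec j) * mps_coeff (\<tau> j) (evec i)) = mps_coeff (mps_compose (\<sigma> i) \<tau>) (evec i)"
    using map_germsD[OF \<sigma> assms(2)] map_germsD[OF \<tau>(1)] by (intro compose_coeff_evec[symmetric])
  also have "\<dots> \<noteq> 0" by (simp add: \<tau>(2) coeff_var)
  finally obtain j where "j \<in> {..<l}" "mps_coeff (\<sigma> i) (evec j) * mps_coeff (\<tau> j) (evec i) \<noteq> 0"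
    by (rule sum.not_neutral_contains_not_neutral)
  then show thesis using that by auto
qed

section \<open>Invariance of curve germs and of primitivity\<close>

lemma A_act_curve_germs:
  assumes "\<phi> \<in> curve_germs n" "(\<rho>, \<sigma>) \<in> A_group n"
  shows "A_act \<rho> \<sigma> \<phi> \<in> curve_germs n"
proof -
  have \<rho>: "\<rho> \<in> diff1" and \<sigma>: "\<sigma> \<in> map_germs (n + 1)"
    using assms(2) by (auto simp: A_group_def diffs_def)
  have \<phi>: "\<phi> i \<in> conv_fps" "fps_nth (\<phi> i) 0 = 0" if "i < n + 1" for i
    using assms(1) that by (auto simp: curve_germs_def)
  show ?thesis
    unfolding curve_germs_def A_act_def
  proof (intro CollectI allI impI conjI)
    fix i assume "i \<le> n"
    then have i: "i < n + 1" by simp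
    show "fps_compose (mps_subst_fps (\<sigma> i) \<phi>) (fps_inv \<rho>) \<in> conv_fps"
      by (intro conv_fps_compose conv_fps_subst[OF map_germsD(1)[OF \<sigma> i] \<phi>] diff1D[OF \<rho>])
    show "fps_nth (fps_compose (mps_subst_fps (\<sigma> i) \<phi>) (fps_inv \<rho>)) 0 = 0"
      using subst_fps_nth_0[OF map_germsD(2)[OF \<sigma> i] \<phi>(2)] map_germsD(3)[OF \<sigma> i] by simp
  qed
qed

text \<open>A factorization of the new curve through \<open>\<tau>\<close> pulls back: applying the
  inverse \<open>\<sigma>'\<close> factors \<open>\<phi>\<close> through \<open>\<tau>\<close>
  composed with \<open>\<rho>\<close>, which again has order at least \<open>2\<close>.\<close>

lemma A_act_primitive:
  assumes \<phi>: "\<phi> \<in> curve_germs n" "primitive_germ n \<phi>" and A: "(\<rho>, \<sigma>) \<in> A_group n"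
  shows "primitive_germ n (A_act \<rho> \<sigma> \<phi>)"
  unfolding primitive_germ_def
proof safe
  fix \<psi> \<tau>
  assume \<psi>: "\<psi> \<in> curve_germs n" and \<tau>: "\<tau> \<in> conv_fps" "fps_nth \<tau> 0 = 0" "2 \<le> fps_ord \<tau>"
    and eq: "\<forall>i\<le>n. A_act \<rho> \<sigma> \<phi> i = fps_compose (\<psi> i) \<tau>"
  have \<rho>: "\<rho> \<in> diff1" and \<sigma>: "\<sigma> \<in> map_germs (n + 1)"
    using A by (auto simp: A_group_def diffs_def)
  obtain \<sigma>' where \<sigma>': "\<sigma>' \<in> map_germs (n + 1)"
    and inv: "\<And>i. i < n + 1 \<Longrightarrow> mps_compose (\<sigma>' i) \<sigma> = mps_var i"
    using A by (auto simp: A_group_def diffs_def)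
  have \<phi>0: "fps_nth (\<phi> i) 0 = 0" and \<psi>0: "\<psi> i \<in> conv_fps" "fps_nth (\<psi> i) 0 = 0" if "i < n + 1" for i
    using \<phi>(1) \<psi> that by (auto simp: curve_germs_def)
  define \<theta> where "\<theta> = fps_compose \<tau> \<rho>"
  have \<theta>: "\<theta> \<in> conv_fps" "fps_nth \<theta> 0 = 0" "2 \<le> fps_ord \<theta>"
  proof -
    show "\<theta> \<in> conv_fps" unfolding \<theta>_def by (intro conv_fps_compose \<tau> diff1D[OF \<rho>])
    show "fps_nth \<theta> 0 = 0" by (simp add: \<theta>_def \<tau>)
    have "fps_nth \<theta> 1 = 0"
      using fps_compose_leading(2)[of \<rho> 1 \<tau>] diff1D(2)[OF \<rho>] \<tau>
      by (simp add: \<theta>_def fps_ord_ge_2_iff)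
    then show "2 \<le> fps_ord \<theta>" using \<open>fps_nth \<theta> 0 = 0\<close> by (simp add: fps_ord_ge_2_iff)
  qed
  have q: "mps_subst_fps (\<sigma> i) \<phi> = fps_compose (\<psi> i) \<theta>" if "i < n + 1" for i
  proof -
    have "mps_subst_fps (\<sigma> i) \<phi> = fps_compose (A_act \<rho> \<sigma> \<phi> i) \<rho>"
      by (simp add: A_act_def fps_compose_inv_cancel[OF \<rho>])
    then show ?thesis
      using eq that diff1D(2)[OF \<rho>] \<tau>(2) by (simp add: \<theta>_def fps_compose_assoc)
  qed
  have "\<phi> i = fps_compose (mps_subst_fps (\<sigma>' i) \<psi>) \<theta>" if i: "i < n + 1" for i
  proof -
    have "\<phi> i = mps_subst_fps (mps_compose (\<sigma>' i) \<sigma>) \<phi>"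
      by (simp only: inv[OF i] subst_fps_var)
    also have "\<dots> = mps_subst_fps (\<sigma>' i) (\<lambda>j. mps_subst_fps (\<sigma> j) \<phi>)"
      by (intro subst_fps_compose[of _ "n + 1" _ "n + 1"] map_germsD[OF \<sigma>' i] map_germsD[OF \<sigma>] \<phi>0)
    also have "\<dots> = mps_subst_fps (\<sigma>' i) (\<lambda>j. fps_compose (\<psi> j) \<theta>)"
      by (intro subst_fps_cong[OF map_germsD(2)[OF \<sigma>' i]] q)
    also have "\<dots> = fps_compose (mps_subst_fps (\<sigma>' i) \<psi>) \<theta>"
      by (intro subst_fps_fps_compose[OF map_germsD(2)[OF \<sigma>' i]] \<psi>0 \<theta>)
    finally show ?thesis .
  qed
  moreover have "(\<lambda>i. mps_subst_fps (\<sigma>' i) \<psi>) \<in> curve_germs n"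
    unfolding curve_germs_def
  proof (intro CollectI allI impI conjI)
    fix i assume "i \<le> n"
    then have i: "i < n + 1" by simp
    show "mps_subst_fps (\<sigma>' i) \<psi> \<in> conv_fps"
      by (intro conv_fps_subst[OF map_germsD(1)[OF \<sigma>' i]] \<psi>0)
    show "fps_nth (mps_subst_fps (\<sigma>' i) \<psi>) 0 = 0"
      using subst_fps_nth_0[OF map_germsD(2)[OF \<sigma>' i] \<psi>0(2)] map_germsD(3)[OF \<sigma>' i] by simp
  qed
  ultimately show False
    using \<phi>(2) \<theta> unfolding primitive_germ_def by (metis less_Suc_eq_le Suc_eq_plus1)
qed


section \<open>Curves with prescribed orders\<close>

text \<open>In zero variables only constants remain. This makes the conditions on \<open>v\<close>
  the case of index \<open>0\<close> of those on the \<open>w i\<close>.\<close>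

lemma value_set_0: "value_set 0 p \<subseteq> {0}"
proof -
  have "subdegree (mps_subst_fps g p) = 0" if "g \<in> conv_mps 0" "mps_subst_fps g p \<noteq> 0" for g
  proof -
    have g: "g \<in> mps_vars 0" using that(1) by (rule conv_mps_vars)
    have "midx 0 m = {0}" for m by (auto simp: midx_def)
    then have "fps_nth (mps_subst_fps g p) m = mps_coeff g 0 * fps_nth 1 m" for m
      using subst_fps_nth[OF g, of p m m] by simp
    then have "mps_subst_fps g p = fps_const (mps_coeff g 0)"
      by (intro fps_ext) simp
    then show ?thesis by simp
  qed
  then show ?thesis by (auto simp: value_set_def)
qed

definition mps_restrict :: "(mindex \<Rightarrow> bool) \<Rightarrow> 'a::zero mps \<Rightarrow> 'a mps" where
  "mps_restrict P f = Abs_mps (\<lambda>\<alpha>. if P \<alpha> then mps_coeff f \<alpha> else 0)"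

lemma coeff_restrict [simp]: "mps_coeff (mps_restrict P f) \<alpha> = (if P \<alpha> then mps_coeff f \<alpha> else 0)"
  by (simp add: mps_restrict_def Abs_mps_inverse)

lemma subst_fps_restrict_nth:
  assumes "\<And>\<alpha>. mps_coeff f \<alpha> \<noteq> 0 \<Longrightarrow> \<not> P \<alpha> \<Longrightarrow> fps_nth (mpower p \<alpha>) m = 0"
  shows "fps_nth (mps_subst_fps (mps_restrict P f) p) m = fps_nth (mps_subst_fps f p) m"
proof -
  have "mps_coeff (mps_restrict P f) \<alpha> * fps_nth (mpower p \<alpha>) m = mps_coeff f \<alpha> * fps_nth (mpower p \<alpha>) m" for \<alpha>
    using assms[of \<alpha>] by auto
  then show ?thesis by (simp only: mps_subst_fps_def fps_nth_Abs_fps)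
qed

lemma value_setI:
  assumes "g \<in> conv_mps l" "\<And>m. m < k \<Longrightarrow> fps_nth (mps_subst_fps g p) m = 0"
    "fps_nth (mps_subst_fps g p) k \<noteq> 0"
  shows "k \<in> value_set l p"
proof -
  have "subdegree (mps_subst_fps g p) = k"
    using assms(2,3) by (intro subdegreeI)
  moreover have "mps_subst_fps g p \<noteq> 0" using assms(3) by auto
  ultimately show ?thesis using assms(1) by (auto simp: value_set_def)
qed

lemma value_setE:
  assumes "k \<in> value_set l p"
  obtains g where "g \<in> conv_mps l" "\<And>m. m < k \<Longrightarrow> fps_nth (mps_subst_fps g p) m = 0"
    "fps_nth (mps_subst_fps g p) k \<noteq> 0"
  using assms nth_less_subdegree_zero by (fastforce simp: value_set_def)

text \<open>Only orders are prescribed, with leading coefficients merely nonzero, and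
  \<open>X\<close> is treated uniformly with the \<open>Y\<^sub>k\<close> through
  \<open>w 0\<close>.\<close>

locale ordered_curve =
  fixes n :: nat and w :: "nat \<Rightarrow> nat" and p :: "nat \<Rightarrow> complex fps"
  assumes w_pos: "0 < w 0"
    and w_mono: "i < j \<Longrightarrow> j \<le> n \<Longrightarrow> w i < w j"
    and low: "i \<le> n \<Longrightarrow> m < w i \<Longrightarrow> fps_nth (p i) m = 0"
    and leading: "i \<le> n \<Longrightarrow> fps_nth (p i) (w i) \<noteq> 0"
begin

lemma w_mono': "i \<le> j \<Longrightarrow> j \<le> n \<Longrightarrow> w i \<le> w j"
  using w_mono[of i j] by (cases "i = j") auto

lemma w_ge_1: "i \<le> n \<Longrightarrow> 1 \<le> w i"
  using w_mono'[of 0 i] w_pos by simp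

lemma p_nth_0: "i < n + 1 \<Longrightarrow> fps_nth (p i) 0 = 0"
  using w_ge_1[of i] low[of i 0] by simp

lemma mpower_nth_eq_0:
  assumes "Poly_Mapping.keys \<alpha> \<subseteq> {..<n + 1}" "m < weight w \<alpha>"
  shows "fps_nth (mpower p \<alpha>) m = 0"
  by (rule nth_mpower_eq_0[OF _ assms(2)]) (use assms(1) low in \<open>auto simp: fps_X_power_dvd_iff\<close>)

lemma mdeg_le_weight': "Poly_Mapping.keys \<alpha> \<subseteq> {..<n + 1} \<Longrightarrow> mdeg \<alpha> \<le> weight w \<alpha>"
  using w_ge_1 by (intro mdeg_le_weight) auto

text \<open>A monomial that involves a variable of index at least \<open>i\<close> has weight at
  least \<open>w i > s\<close>, so removing it leaves all coefficients up to order \<open>s\<close>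
  unchanged. Hence no value of the curve below \<open>w i\<close> is missing from
  \<open>\<Gamma>\<close> with index \<open>i\<close>, which gives minimality of
  \<open>w i\<close>.\<close>

lemma small_value:
  assumes "s \<in> value_set (n + 1) p" "i \<le> n" "s < w i"
  shows "s \<in> value_set i p"
proof -
  obtain g where g: "g \<in> conv_mps (n + 1)" "\<And>m. m < s \<Longrightarrow> fps_nth (mps_subst_fps g p) m = 0"
    "fps_nth (mps_subst_fps g p) s \<noteq> 0"
    using assms(1) by (rule value_setE) blast
  \<comment> \<open>The degree bound makes the truncation a polynomial, hence convergent. It is
    harmless because all weights are at least \<open>1\<close>, so the weight is at least the
    degree.\<close>
  define P where "P = (\<lambda>\<alpha>. Poly_Mapping.keys \<alpha> \<subseteq> {..<i} \<and> mdeg \<alpha> \<le> s)"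
  have eq: "fps_nth (mps_subst_fps (mps_restrict P g) p) m = fps_nth (mps_subst_fps g p) m" if "m \<le> s" for m
  proof (rule subst_fps_restrict_nth)
    fix \<alpha> assume \<alpha>: "mps_coeff g \<alpha> \<noteq> 0" "\<not> P \<alpha>"
    have K: "Poly_Mapping.keys \<alpha> \<subseteq> {..<n + 1}"
      using mps_varsD[OF conv_mps_vars[OF g(1)] \<alpha>(1)] .
    have "s < weight w \<alpha>"
    proof (cases "mdeg \<alpha> \<le> s")
      case True
      then have "\<not> Poly_Mapping.keys \<alpha> \<subseteq> {..<i}"
        using \<alpha>(2) by (simp add: P_def)
      then obtain j where j: "j \<in> Poly_Mapping.keys \<alpha>" "i \<le> j"
        by (meson lessThan_iff not_less subsetI)
      then obtain \<beta> where "\<alpha> = evec j + \<beta>" using mindex_split_var by blast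
      then have "w j \<le> weight w \<alpha>" by (simp add: weight_add)
      moreover have "w i \<le> w j" using j K by (intro w_mono') auto
      ultimately show ?thesis using assms(3) by simp
    qed (use mdeg_le_weight'[OF K] in simp)
    then show "fps_nth (mpower p \<alpha>) m = 0" using that by (intro mpower_nth_eq_0 K) simp
  qed
  show ?thesis
  proof (rule value_setI)
    show "mps_restrict P g \<in> conv_mps i"
    proof (rule conv_mps_finite_support)
      show "mps_restrict P g \<in> mps_vars i"
        by (auto simp: mps_vars_def P_def split: if_splits)
      show "finite {\<alpha>. mps_coeff (mps_restrict P g) \<alpha> \<noteq> 0}"
        by (rule finite_subset[OF _ finite_midx[of i "s"]]) (auto simp: P_def midx_def)
    qed
  qed (use g eq in auto)
qed

text \<open>Every monomial of \<open>H\<close> that is not a monomial in the first \<open>k\<close> variables of degree at most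
  \<open>w k\<close> takes an order greater than \<open>w k\<close> on the curve, because \<open>Y\<^sub>k\<close> itself does not occur.\<close>

lemma critical_value:
  assumes H: "H \<in> mps_vars (n + 1)" and k: "k \<le> n" and Hlin: "\<And>j. j \<le> k \<Longrightarrow> mps_coeff H (evec j) = 0"
    and ord: "\<And>m. m < w k \<Longrightarrow> fps_nth (mps_subst_fps H p) m = 0"
    "fps_nth (mps_subst_fps H p) (w k) \<noteq> 0"
  shows "w k \<in> value_set k p"
proof -
  define P where "P = (\<lambda>\<alpha>. Poly_Mapping.keys \<alpha> \<subseteq> {..<k} \<and> mdeg \<alpha> \<le> w k)"
  have eq: "fps_nth (mps_subst_fps (mps_restrict P H) p) m = fps_nth (mps_subst_fps H p) m" if "m \<le> w k" for m
  proof (rule subst_fps_restrict_nth)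
    fix \<alpha> assume \<alpha>: "mps_coeff H \<alpha> \<noteq> 0" "\<not> P \<alpha>"
    have K: "Poly_Mapping.keys \<alpha> \<subseteq> {..<n + 1}"
      using mps_varsD[OF H \<alpha>(1)] .
    have "w k < weight w \<alpha>"
    proof (cases "mdeg \<alpha> \<le> w k")
      case True
      then have "\<not> Poly_Mapping.keys \<alpha> \<subseteq> {..<k}"
        using \<alpha>(2) by (simp add: P_def)
      then obtain j where j: "j \<in> Poly_Mapping.keys \<alpha>" "k \<le> j"
        by (meson lessThan_iff not_less subsetI)
      then obtain \<beta> where \<beta>: "\<alpha> = evec j + \<beta>" using mindex_split_var by blast
      have jn: "j \<le> n" using j K by auto
      show ?thesis
      \<comment> \<open>For \<open>\<beta> = 0\<close> the monomial is a single variable, excluded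
        by \<open>Hlin\<close> when \<open>j \<le> k\<close> and of larger order when
        \<open>j > k\<close>. Otherwise \<open>\<beta>\<close> adds at least \<open>1\<close> to
        \<open>w j \<ge> w k\<close>.\<close>
      proof (cases "\<beta> = 0")
        case True
        then have "\<not> j \<le> k" using Hlin[of j] \<alpha>(1) \<beta> by auto
        then show ?thesis using True \<beta> w_mono[of k j] jn by simp
      next
        case False
        then have "1 \<le> mdeg \<beta>" using mdeg_eq_0_iff[of \<beta>] by linarith
        also have "\<dots> \<le> weight w \<beta>"
          using K \<beta> by (intro mdeg_le_weight') (auto simp: keys_add_nat)
        finally show ?thesis using \<beta> w_mono'[OF j(2) jn] by (simp add: weight_add)
      qed
    qed (use mdeg_le_weight'[OF K] in simp)
    then show "fps_nth (mpower p \<alpha>) m = 0" using that by (intro mpower_nth_eq_0 K) simp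
  qed
  show ?thesis
  proof (rule value_setI)
    show "mps_restrict P H \<in> conv_mps k"
    proof (rule conv_mps_finite_support)
      show "mps_restrict P H \<in> mps_vars k"
        by (auto simp: mps_vars_def P_def split: if_splits)
      show "finite {\<alpha>. mps_coeff (mps_restrict P H) \<alpha> \<noteq> 0}"
        by (rule finite_subset[OF _ finite_midx[of k "w k"]]) (auto simp: P_def midx_def)
    qed
  qed (use ord eq in auto)
qed

end

text \<open>Given the orders, this non-membership already yields the minimality in the definition of
  the class, through \<open>small_value\<close>.\<close>

locale adapted_curve = ordered_curve +
  assumes gap: "i \<le> n \<Longrightarrow> w i \<notin> value_set i p"
begin

lemma linear_part_eq_0:
  assumes H: "H \<in> mps_vars (n + 1)" and k: "k \<le> n"
    and ord: "\<And>m. m \<le> w k \<Longrightarrow> fps_nth (mps_subst_fps H p) m = 0"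
  shows "j \<le> k \<Longrightarrow> mps_coeff H (evec j) = 0"
\<comment> \<open>Strong induction, because \<open>critical_value\<close> at index \<open>j\<close>
  requires the linear coefficients at all smaller indices to vanish as well.\<close>
proof (induction j rule: less_induct)
  case (less j)
  show ?case
  proof (rule ccontr)
    define c where "c = mps_coeff H (evec j)"
    assume "mps_coeff H (evec j) \<noteq> 0"
    then have c: "c \<noteq> 0" by (simp add: c_def)
    have j: "j \<le> n" using less.prems k by simp
    have V: "(mps_var j :: complex mps) \<in> mps_vars (n + 1)"
      using j by (intro conv_mps_vars conv_mps_var) simp
    have CV: "mps_const c * mps_var j \<in> mps_vars (n + 1)" using V by (rule mps_vars_const_mult)
    \<comment> \<open>On the curve \<open>H\<close> has order above \<open>w k \<ge> w j\<close>, so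
      the order of \<open>G\<close> there is that of \<open>p j\<close>, namely
      \<open>w j\<close>.\<close>
    define G where "G = H - mps_const c * mps_var j"
    have subst: "mps_subst_fps G p = mps_subst_fps H p - fps_const c * p j"
    proof -
      have "mps_subst_fps G p = mps_subst_fps H p - mps_subst_fps (mps_const c * mps_var j) p"
        unfolding G_def by (rule subst_fps_diff[OF H CV p_nth_0])
      also have "mps_subst_fps (mps_const c * mps_var j) p = fps_const c * mps_subst_fps (mps_var j) p"
        by (rule subst_fps_const_mult[OF V p_nth_0])
      finally show ?thesis by (simp only: subst_fps_var)
    qed
    have wj: "w j \<le> w k" using less.prems k by (rule w_mono')
    have "w j \<in> value_set j p"
    proof (rule critical_value)
      show "G \<in> mps_vars (n + 1)" unfolding G_def using H CV by (rule mps_vars_diff)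
      show "mps_coeff G (evec i) = 0" if "i \<le> j" for i
        using that less.IH[of i] less.prems by (cases "i = j") (auto simp: G_def coeff_var c_def)
      show "fps_nth (mps_subst_fps G p) m = 0" if "m < w j" for m
        using that wj low[OF j that] by (simp add: subst ord)
      show "fps_nth (mps_subst_fps G p) (w j) \<noteq> 0"
        using wj leading[OF j] c by (simp add: subst ord)
    qed (fact j)
    then show False using gap[OF j] by simp
  qed
qed

text \<open>A zero component satisfies every order bound, so the case \<open>k = n\<close> of
  \<open>linear_part_eq_0\<close> would annihilate a whole row of the Jacobian of
  \<open>\<sigma>\<close>.\<close>

lemma nondegenerate: "nondegenerate n p"
  unfolding nondegenerate_def
proof clarify
  fix \<rho> \<sigma> i
  assume A: "(\<rho>, \<sigma>) \<in> A_group n" and i: "i \<le> n" and 0: "A_act \<rho> \<sigma> p i = 0"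
  have \<rho>: "\<rho> \<in> diff1" and \<sigma>: "\<sigma> \<in> diffs (n + 1)" "\<sigma> i \<in> mps_vars (n + 1)"
    using A i map_germsD(2)[of \<sigma> "n + 1" i] by (auto simp: A_group_def diffs_def)
  have "mps_subst_fps (\<sigma> i) p = fps_compose (A_act \<rho> \<sigma> p i) \<rho>"
    by (simp add: A_act_def fps_compose_inv_cancel[OF \<rho>])
  then have "mps_subst_fps (\<sigma> i) p = 0" by (simp add: 0)
  then have "mps_coeff (\<sigma> i) (evec j) = 0" if "j \<le> n" for j
    using linear_part_eq_0[OF \<sigma>(2), of n j] that by simp
  moreover obtain j where "j < n + 1" "mps_coeff (\<sigma> i) (evec j) \<noteq> 0"
    using diffs_linear_part[OF \<sigma>(1), of i] i by auto
  ultimately show False by simp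
qed

text \<open>The linear part of \<open>g \<circ> \<sigma>\<close> vanishes: its first nonzero coefficient, say with index \<open>j < i\<close>,
  would force \<open>g \<circ> \<sigma>\<close> to have order at most \<open>w j < w i\<close> on the curve.\<close>

lemma A_act_gap:
  assumes A: "(\<rho>, \<sigma>) \<in> A_group n" and i: "i \<le> n"
    and tri: "\<And>j k. j < k \<Longrightarrow> k \<le> n \<Longrightarrow> mps_coeff (\<sigma> k) (evec j) = 0"
    and diag: "\<And>k. k \<le> n \<Longrightarrow> mps_coeff (\<sigma> k) (evec k) \<noteq> 0"
  shows "w i \<notin> value_set i (A_act \<rho> \<sigma> p)"
proof
  assume "w i \<in> value_set i (A_act \<rho> \<sigma> p)"
  then obtain g where g: "g \<in> conv_mps i"
    "\<And>m. m < w i \<Longrightarrow> fps_nth (mps_subst_fps g (A_act \<rho> \<sigma> p)) m = 0"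
    "fps_nth (mps_subst_fps g (A_act \<rho> \<sigma> p)) (w i) \<noteq> 0"
    by (rule value_setE) blast
  have gv: "g \<in> mps_vars i" using g(1) by (rule conv_mps_vars)
  have \<rho>: "\<rho> \<in> diff1" and \<sigma>: "\<sigma> \<in> map_germs (n + 1)"
    using A by (auto simp: A_group_def diffs_def)
  have \<sigma>i: "\<sigma> j \<in> mps_vars (n + 1)" "mps_coeff (\<sigma> j) 0 = 0" if "j < i" for j
    using that i map_germsD[OF \<sigma>, of j] by auto
  define G where "G = mps_compose g \<sigma>"
  have G: "G \<in> mps_vars (n + 1)"
    unfolding G_def using gv \<sigma>i by (rule mps_vars_compose)
  have "mps_subst_fps g (A_act \<rho> \<sigma> p) = fps_compose (mps_subst_fps g (\<lambda>j. mps_subst_fps (\<sigma> j) p)) (fps_inv \<rho>)"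
    unfolding A_act_def
  proof (rule subst_fps_fps_compose[OF gv])
    show "fps_nth (mps_subst_fps (\<sigma> j) p) 0 = 0" if "j < i" for j
      using subst_fps_nth_0[OF \<sigma>i(1)[OF that] p_nth_0] \<sigma>i(2)[OF that] by simp
  qed (fact diff1D(5)[OF \<rho>])
  also have "mps_subst_fps g (\<lambda>j. mps_subst_fps (\<sigma> j) p) = mps_subst_fps G p"
    unfolding G_def using gv \<sigma>i p_nth_0 by (rule subst_fps_compose[symmetric])
  \<comment> \<open>Undoing the reparametrization returns to the original curve, and the order is
    preserved because \<open>\<rho>\<close> has nonzero derivative.\<close>
  finally have eq: "mps_subst_fps G p = fps_compose (mps_subst_fps g (A_act \<rho> \<sigma> p)) \<rho>"
    by (simp add: fps_compose_inv_cancel[OF \<rho>])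
  have low_G: "fps_nth (mps_subst_fps G p) m = 0" if "m < w i" for m
    unfolding eq using fps_compose_leading(1)[OF diff1D(2)[OF \<rho>] g(2) that] .
  have lead_G: "fps_nth (mps_subst_fps G p) (w i) \<noteq> 0"
    unfolding eq using fps_compose_leading(2)[OF diff1D(2)[OF \<rho>] g(2)] g(3) diff1D(3)[OF \<rho>] by simp
  have lin_G: "mps_coeff G (evec l) = (\<Sum>j<i. mps_coeff g (evec j) * mps_coeff (\<sigma> j) (evec l))" for l
    unfolding G_def by (rule compose_coeff_evec[OF gv \<sigma>i(2)])
  have lin_g: "j < i \<Longrightarrow> mps_coeff g (evec j) = 0" for j
  proof (induction j rule: less_induct)
    case (less j)
    \<comment> \<open>Terms with \<open>j' < j\<close> vanish by induction and those with
      \<open>j' > j\<close> by triangularity; the diagonal term alone survives.\<close>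
    have "mps_coeff G (evec j) = (\<Sum>j'\<in>{j}. mps_coeff g (evec j') * mps_coeff (\<sigma> j') (evec j))"
      unfolding lin_G
    proof (rule sum.mono_neutral_right)
      show "\<forall>j'\<in>{..<i} - {j}. mps_coeff g (evec j') * mps_coeff (\<sigma> j') (evec j) = 0"
      proof
        fix j' assume "j' \<in> {..<i} - {j}"
        then have "j' < j \<or> j < j'" "j' < i" by auto
        then show "mps_coeff g (evec j') * mps_coeff (\<sigma> j') (evec j) = 0"
          using less.IH[of j'] tri[of j j'] i by auto
      qed
    qed (use less.prems in auto)
    moreover have "mps_coeff G (evec j) = 0"
    proof (rule linear_part_eq_0[OF G])
      show "fps_nth (mps_subst_fps G p) m = 0" if "m \<le> w j" for m
        using that w_mono[OF less.prems i] by (intro low_G) simp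
    qed (use less.prems i in auto)
    ultimately show ?case using diag[of j] less.prems i by simp
  qed
  \<comment> \<open>Without linear part, \<open>G\<close> has order exactly \<open>w i\<close> on
    the original curve, which is the situation excluded by its gap.\<close>
  have "w i \<in> value_set i p"
    by (rule critical_value[OF G i _ low_G lead_G]) (simp add: lin_G lin_g)
  then show False using gap[OF i] by simp
qed

end

text \<open>Trades the two minimality conditions and nondegeneracy, which quantify over all series
  and all diffeomorphisms, for the orders of the components and the gaps. Both directions of the
  theorem use only this form.\<close>

lemma P_class_iff:
  assumes "n \<ge> 1" "w 0 = v"
  shows "p \<in> P_class n v w \<longleftrightarrow> p \<in> curve_germs n \<and> primitive_germ n p \<and> adapted_curve n w p \<and>
    p 0 = fps_X ^ v \<and> (\<forall>i\<in>{1..n}. fps_ord (p i - fps_X ^ w i) > enat (w i))"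
proof
  assume P: "p \<in> P_class n v w"
  then have *: "p \<in> curve_germs n" "primitive_germ n p" "p 0 = fps_X ^ v"
    and ord: "\<And>i. i \<in> {1..n} \<Longrightarrow> fps_ord (p i - fps_X ^ w i) > enat (w i)"
    by (auto simp: P_class_def parametrizations_def)
  have v: "v \<noteq> 0" using P by (auto simp: P_class_def is_min_def)
  have nth: "fps_nth (p i) m = fps_nth (fps_X ^ w i) m" if "i \<le> n" "m \<le> w i" for i m
  proof (cases "i = 0")
    case False
    then show ?thesis using ord[of i] that by (auto simp: fps_ord_gt_iff)
  qed (simp add: *(3) assms(2))
  have "adapted_curve n w p"
  proof unfold_locales
    show "0 < w 0" using v assms(2) by simp
    have step: "w i < w (i + 1)" if "i < n" for i
      using P that assms by (cases "i = 0") (auto simp: P_class_def)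
    show "w i < w j" if "i < j" "j \<le> n" for i j
      using that
    proof (induction j)
      case (Suc j)
      then show ?case using step[of j] by (cases "i = j") auto
    qed simp
    show "fps_nth (p i) m = 0" if "i \<le> n" "m < w i" for i m
      using nth[of i m] that by simp
    show "fps_nth (p i) (w i) \<noteq> 0" if "i \<le> n" for i
      using nth[of i "w i"] that by simp
    show "w i \<notin> value_set i p" if "i \<le> n" for i
    proof (cases "i = 0")
      case True
      then show ?thesis using value_set_0[of p] v assms(2) by auto
    next
      case False
      then show ?thesis using P that by (auto simp: P_class_def is_min_def)
    qed
  qed
  then show "p \<in> curve_germs n \<and> primitive_germ n p \<and> adapted_curve n w p \<and>
      p 0 = fps_X ^ v \<and> (\<forall>i\<in>{1..n}. fps_ord (p i - fps_X ^ w i) > enat (w i))"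
    using * ord by blast
next
  assume R: "p \<in> curve_germs n \<and> primitive_germ n p \<and> adapted_curve n w p \<and>
    p 0 = fps_X ^ v \<and> (\<forall>i\<in>{1..n}. fps_ord (p i - fps_X ^ w i) > enat (w i))"
  then interpret adapted_curve n w p by blast
  have mem: "w i \<in> value_set (n + 1) p" if "i \<le> n" for i
    by (rule value_setI[of "mps_var i"])
       (use that low[of i] leading[of i] in \<open>auto simp: conv_mps_var subst_fps_var\<close>)
  have "is_min (w i) (value_set (n + 1) p - value_set i p)" if "i \<le> n" for i
    unfolding is_min_def using mem[OF that] gap[OF that] small_value[OF _ that]
    by (meson DiffD1 DiffD2 DiffI not_less)
  \<comment> \<open>The case \<open>i = 0\<close> of \<open>small_value\<close>: a value below
    \<open>v\<close> comes from a series in no variables, so it is \<open>0\<close>.\<close>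
  moreover have "is_min v (value_set (n + 1) p - {0})"
    unfolding is_min_def using mem[of 0] w_pos small_value[of _ 0] value_set_0[of p] assms(2)
    by (auto simp: not_less[symmetric])
  moreover have "v < w 1" "\<forall>i\<in>{1..<n}. w i < w (i + 1)"
    using w_mono[of 0 1] w_mono assms by auto
  ultimately show "p \<in> P_class n v w"
    using R nondegenerate by (auto simp: P_class_def parametrizations_def)
qed


section \<open>The stabilizer of the normal form\<close>

text \<open>After cancelling one factor \<open>t\<close>, the claim is uniqueness of the
  \<open>v\<close>-th root with prescribed nonzero constant term. The constant root-choice function
  selects the branch with value \<open>\<epsilon>\<close>, which is the derivative of
  \<open>\<rho>\<close> at the origin.\<close>

lemma fps_mult_root_iff:
  fixes \<rho> b :: "complex fps"
  assumes v: "v > 0" and e: "\<epsilon> \<noteq> 0" and b: "\<And>m. m \<le> v \<Longrightarrow> fps_nth b m = 0"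
    and \<rho>: "fps_nth \<rho> 0 = 0"
  shows "\<rho> = fps_X * fps_radical (\<lambda>_ _. \<epsilon>) v (fps_const (\<epsilon> ^ v) + b / fps_X ^ v)
    \<longleftrightarrow> fps_nth \<rho> 1 = \<epsilon> \<and> \<rho> ^ v = fps_const (\<epsilon> ^ v) * fps_X ^ v + b"
proof -
  define a where "a = fps_const (\<epsilon> ^ v) + b / fps_X ^ v"
  have "b = fps_X ^ v * fps_shift v b"
    using b by (intro fps_ext) (auto simp: fps_X_power_mult_nth)
  \<comment> \<open>The order of \<open>b\<close> exceeds \<open>v\<close>, so the quotient is a
    power series without constant term.\<close>
  then have div: "b / fps_X ^ v = fps_shift v b"
    using nonzero_mult_div_cancel_left[of "fps_X ^ v :: complex fps" "fps_shift v b"] by simp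
  have a: "fps_X ^ v * a = fps_const (\<epsilon> ^ v) * fps_X ^ v + b" "fps_nth a 0 = \<epsilon> ^ v"
    using b \<open>b = fps_X ^ v * fps_shift v b\<close> by (simp_all add: a_def div distrib_left mult.commute)
  have a0: "fps_nth a 0 \<noteq> 0" using a(2) e by simp
  obtain k where k: "v = Suc k" using v by (cases v) auto
  define R where "R = fps_shift 1 \<rho>"
  have R: "\<rho> = fps_X * R" "fps_nth R 0 = fps_nth \<rho> 1"
  proof -
    show "\<rho> = fps_X * R"
      using \<rho> by (intro fps_ext) (auto simp: R_def)
  qed (simp add: R_def)
  have "\<rho> = fps_X * fps_radical (\<lambda>_ _. \<epsilon>) v a \<longleftrightarrow> R = fps_radical (\<lambda>_ _. \<epsilon>) v a"
    unfolding R(1) by simp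
  also have "\<dots> \<longleftrightarrow> fps_nth R 0 = \<epsilon> \<and> R ^ v = a"
  proof (cases "fps_nth R 0 = \<epsilon>")
    case True
    have "R ^ Suc k = a \<longleftrightarrow> R = fps_radical (\<lambda>_ _. \<epsilon>) (Suc k) a"
      by (rule radical_unique) (use a(2) a0 True in \<open>simp_all only: k simp_thms\<close>)
    then show ?thesis using True by (simp only: k simp_thms)
  next
    case False
    \<comment> \<open>The radical has constant term \<open>\<epsilon>\<close>, so with a different
      constant term both sides of the equivalence fail.\<close>
    then have "R \<noteq> fps_radical (\<lambda>_ _. \<epsilon>) v a"
      unfolding k by (metis fps_radical_nth_0 nat.distinct(1))
    then show ?thesis using False by simp
  qed
  also have "R ^ v = a \<longleftrightarrow> \<rho> ^ v = fps_const (\<epsilon> ^ v) * fps_X ^ v + b"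
    unfolding R(1) power_mult_distrib a(1)[symmetric] by simp
  finally show ?thesis by (simp only: a_def R(2))
qed

theorem proposition4p3:
  fixes n v\<^sub>0 :: nat and w :: "nat \<Rightarrow> nat"
    and \<phi> :: "nat \<Rightarrow> complex fps"
    and \<rho> :: "complex fps" and \<sigma> :: "nat \<Rightarrow> complex mps"
  assumes "n \<ge> 1"
    and "w 0 = v\<^sub>0"
    and "\<phi> \<in> P_class n v\<^sub>0 w"
    and "(\<rho>, \<sigma>) \<in> A_group n"
  shows "A_act \<rho> \<sigma> \<phi> \<in> P_class n v\<^sub>0 w \<longleftrightarrow>
    (\<exists>(\<epsilon> :: complex) (h :: nat \<Rightarrow> complex mps).
       \<epsilon> \<noteq> 0 \<and>
       (\<forall>k\<le>n. h k \<in> Idl\<^bsub>conv_ring (n + 1)\<^esub> (mps_var ` {k + 1..n})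
                    <+>\<^bsub>conv_ring (n + 1)\<^esub> (max_ideal (n + 1) \<cdot>\<^bsub>conv_ring (n + 1)\<^esub> max_ideal (n + 1)) \<and>
              fps_ord (mps_subst_fps (h k) \<phi>) > enat (w k)) \<and>
       \<rho> = fps_X * fps_radical (\<lambda>_ _. \<epsilon>) v\<^sub>0
                      (fps_const (\<epsilon> ^ v\<^sub>0) + mps_subst_fps (h 0) \<phi> / fps_X ^ v\<^sub>0) \<and>
       \<sigma> 0 = mps_const (\<epsilon> ^ v\<^sub>0) * mps_var 0 + h 0 \<and>
       (\<forall>k\<in>{1..n}. \<sigma> k = mps_const (\<epsilon> ^ w k) * mps_var k + h k))"
    (is "?lhs \<longleftrightarrow> ?rhs")
proof -
  note P_iff = P_class_iff[of n w v\<^sub>0, OF assms(1,2)]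
  have \<phi>: "\<phi> \<in> curve_germs n" "primitive_germ n \<phi>" "adapted_curve n w \<phi>" "\<phi> 0 = fps_X ^ v\<^sub>0"
    and \<phi>_ord: "\<And>k. k \<in> {1..n} \<Longrightarrow> fps_ord (\<phi> k - fps_X ^ w k) > enat (w k)"
    using assms(3) unfolding P_iff by auto
  interpret adapted_curve n w \<phi> by (fact \<phi>)
  have \<phi>_nth: "fps_nth (\<phi> k) m = fps_nth (fps_X ^ w k) m" if "k \<le> n" "m \<le> w k" for k m
  proof (cases "k = 0")
    case False
    then show ?thesis using \<phi>_ord[of k] that by (auto simp: fps_ord_gt_iff)
  qed (simp add: \<phi>(4) assms(2))
  have v: "v\<^sub>0 > 0" using w_pos assms(2) by simp
  have \<rho>: "\<rho> \<in> diff1" and \<sigma>: "\<sigma> \<in> map_germs (n + 1)"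
    using assms(4) by (auto simp: A_group_def diffs_def)
  note \<rho>D = diff1D[OF \<rho>]
  have \<sigma>v: "\<sigma> k \<in> conv_mps (n + 1)" "\<sigma> k \<in> mps_vars (n + 1)" "mps_coeff (\<sigma> k) 0 = 0" if "k \<le> n" for k
    using map_germsD[OF \<sigma>, of k] that by auto
  have var: "mps_const c * mps_var k \<in> conv_mps (n + 1)" "mps_const c * mps_var k \<in> mps_vars (n + 1)"
    if "k \<le> n" for c :: complex and k
  proof -
    show "mps_const c * mps_var k \<in> conv_mps (n + 1)"
      using that by (intro conv_mps_const_mult conv_mps_var) simp
    then show "mps_const c * mps_var k \<in> mps_vars (n + 1)" by (rule conv_mps_vars)
  qed
  have subst_var: "mps_subst_fps (mps_const c * mps_var k) \<phi> = fps_const c * \<phi> k" if "k \<le> n" for c k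
  proof -
    have "(mps_var k :: complex mps) \<in> mps_vars (n + 1)"
      using that by (intro conv_mps_vars conv_mps_var) simp
    then have "mps_subst_fps (mps_const c * mps_var k) \<phi> = fps_const c * mps_subst_fps (mps_var k) \<phi>"
      by (rule subst_fps_const_mult[OF _ p_nth_0])
    then show ?thesis by (simp only: subst_fps_var)
  qed
  show ?thesis
  proof
    assume ?lhs
    then have act: "A_act \<rho> \<sigma> \<phi> 0 = fps_X ^ v\<^sub>0"
      and act_ord: "\<And>k. k \<in> {1..n} \<Longrightarrow> fps_ord (A_act \<rho> \<sigma> \<phi> k - fps_X ^ w k) > enat (w k)"
      unfolding P_iff by auto
    \<comment> \<open>The value at \<open>t = 0\<close> of the required root is the derivative of
      \<open>\<rho>\<close>, so this is the only candidate; \<open>h k\<close> is then whatever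
      remains of \<open>\<sigma> k\<close>.\<close>
    define \<epsilon> where "\<epsilon> = fps_nth \<rho> 1"
    define h where "h = (\<lambda>k. \<sigma> k - mps_const (\<epsilon> ^ w k) * mps_var k)"
    have \<epsilon>: "\<epsilon> \<noteq> 0" using \<rho>D(3) by (simp add: \<epsilon>_def)
    have q: "mps_subst_fps (\<sigma> k) \<phi> = fps_compose (A_act \<rho> \<sigma> \<phi> k) \<rho>" for k
      by (simp add: A_act_def fps_compose_inv_cancel[OF \<rho>])
    have act_nth: "fps_nth (A_act \<rho> \<sigma> \<phi> k) m = fps_nth (fps_X ^ w k) m" if "k \<le> n" "m \<le> w k" for k m
    proof (cases "k = 0")
      case False
      then show ?thesis using act_ord[of k] that by (auto simp: fps_ord_gt_iff)
    qed (simp add: act assms(2))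
    have subst_h: "mps_subst_fps (h k) \<phi> = mps_subst_fps (\<sigma> k) \<phi> - fps_const (\<epsilon> ^ w k) * \<phi> k" if "k \<le> n" for k
      unfolding h_def subst_var[OF that, symmetric]
      by (rule subst_fps_diff[OF \<sigma>v(2)[OF that] var(2)[OF that] p_nth_0])
    \<comment> \<open>Both \<open>\<sigma> k\<close> on the curve and
      \<open>\<epsilon> ^ w k\<close> times component \<open>k\<close> start with
      \<open>\<epsilon> ^ w k\<close> in order \<open>w k\<close>, and these terms cancel.\<close>
    have h_ord: "fps_nth (mps_subst_fps (h k) \<phi>) m = 0" if k: "k \<le> n" and m: "m \<le> w k" for k m
    proof -
      have low': "fps_nth (A_act \<rho> \<sigma> \<phi> k) i = 0" if "i < w k" for i
        using act_nth[OF k, of i] that by simp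
      show ?thesis
      proof (cases "m = w k")
        case True
        then show ?thesis
          using fps_compose_leading(2)[OF \<rho>D(2) low'] act_nth[OF k, of "w k"] \<phi>_nth[OF k, of "w k"]
          by (simp add: subst_h[OF k] q \<epsilon>_def)
      next
        case False
        then have "m < w k" using m by simp
        then show ?thesis
          using fps_compose_leading(1)[OF \<rho>D(2) low'] low[OF k] by (simp add: subst_h[OF k] q)
      qed
    qed
    have h_conv: "h k \<in> conv_mps (n + 1)" "mps_coeff (h k) 0 = 0" if "k \<le> n" for k
      using \<sigma>v[OF that] var(1)[OF that]
      by (auto simp: h_def coeff_var evec_nonzero[symmetric] intro: conv_mps_diff)
    have "\<rho> = fps_X * fps_radical (\<lambda>_ _. \<epsilon>) v\<^sub>0
        (fps_const (\<epsilon> ^ v\<^sub>0) + mps_subst_fps (h 0) \<phi> / fps_X ^ v\<^sub>0)"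
    proof (subst fps_mult_root_iff[OF v \<epsilon> _ \<rho>D(2)])
      show "fps_nth (mps_subst_fps (h 0) \<phi>) m = 0" if "m \<le> v\<^sub>0" for m
        using h_ord[of 0 m] that assms(2) by simp
      \<comment> \<open>Component \<open>0\<close> of the new curve is a pure power, and composing
        it with \<open>\<rho>\<close> gives the same power of \<open>\<rho>\<close>.\<close>
      have "mps_subst_fps (\<sigma> 0) \<phi> = \<rho> ^ v\<^sub>0"
        unfolding q act using \<rho>D(2) by (simp flip: fps_compose_power)
      then show "fps_nth \<rho> 1 = \<epsilon> \<and> \<rho> ^ v\<^sub>0 = fps_const (\<epsilon> ^ v\<^sub>0) * fps_X ^ v\<^sub>0 + mps_subst_fps (h 0) \<phi>"
        using subst_h[of 0] \<phi>(4) assms(2) by (simp add: \<epsilon>_def)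
    qed
    moreover have "h k \<in> Idl\<^bsub>conv_ring (n + 1)\<^esub> (mps_var ` {k + 1..n})
        <+>\<^bsub>conv_ring (n + 1)\<^esub> (max_ideal (n + 1) \<cdot>\<^bsub>conv_ring (n + 1)\<^esub> max_ideal (n + 1))" if "k \<le> n" for k
      unfolding tail_ideal_iff[OF that]
      using h_conv[OF that] linear_part_eq_0[OF conv_mps_vars that h_ord[OF that]] by blast
    moreover have "enat (w k) < fps_ord (mps_subst_fps (h k) \<phi>)" if "k \<le> n" for k
      using h_ord[OF that] by (simp add: fps_ord_gt_iff)
    ultimately show ?rhs
      using \<epsilon> assms(2) by (intro exI[of _ \<epsilon>] exI[of _ h]) (auto simp: h_def)
  next
    assume ?rhs
    then obtain \<epsilon> h where \<epsilon>: "\<epsilon> \<noteq> 0"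
      and h: "\<And>k. k \<le> n \<Longrightarrow> h k \<in> Idl\<^bsub>conv_ring (n + 1)\<^esub> (mps_var ` {k + 1..n})
        <+>\<^bsub>conv_ring (n + 1)\<^esub> (max_ideal (n + 1) \<cdot>\<^bsub>conv_ring (n + 1)\<^esub> max_ideal (n + 1))"
      and h_ord: "\<And>k. k \<le> n \<Longrightarrow> enat (w k) < fps_ord (mps_subst_fps (h k) \<phi>)"
      and root: "\<rho> = fps_X * fps_radical (\<lambda>_ _. \<epsilon>) v\<^sub>0
        (fps_const (\<epsilon> ^ v\<^sub>0) + mps_subst_fps (h 0) \<phi> / fps_X ^ v\<^sub>0)"
      and \<sigma>_eqs: "\<sigma> 0 = mps_const (\<epsilon> ^ v\<^sub>0) * mps_var 0 + h 0"
        "\<forall>k\<in>{1..n}. \<sigma> k = mps_const (\<epsilon> ^ w k) * mps_var k + h k"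
      by blast
    have \<sigma>_eq: "\<sigma> k = mps_const (\<epsilon> ^ w k) * mps_var k + h k" if "k \<le> n" for k
      using \<sigma>_eqs that assms(2) by (cases "k = 0") auto
    have hD: "h k \<in> mps_vars (n + 1)" "\<And>j. j \<le> k \<Longrightarrow> mps_coeff (h k) (evec j) = 0" if "k \<le> n" for k
      using h[OF that] unfolding tail_ideal_iff[OF that] by (auto intro: conv_mps_vars)
    have h_nth: "fps_nth (mps_subst_fps (h k) \<phi>) m = 0" if "k \<le> n" "m \<le> w k" for k m
      using h_ord[OF that(1)] that(2) by (simp add: fps_ord_gt_iff)
    have q: "mps_subst_fps (\<sigma> k) \<phi> = fps_const (\<epsilon> ^ w k) * \<phi> k + mps_subst_fps (h k) \<phi>" if "k \<le> n" for k
      unfolding \<sigma>_eq[OF that] subst_var[OF that, symmetric]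
      by (rule subst_fps_add[OF var(2)[OF that] hD(1)[OF that] p_nth_0])
    \<comment> \<open>The root formula read backwards. The power equation makes component
      \<open>0\<close> of the new curve exactly a pure power, not merely one with the right leading
      term.\<close>
    have "fps_nth \<rho> 1 = \<epsilon> \<and> \<rho> ^ v\<^sub>0 = fps_const (\<epsilon> ^ v\<^sub>0) * fps_X ^ v\<^sub>0 + mps_subst_fps (h 0) \<phi>"
      by (rule fps_mult_root_iff[OF v \<epsilon> _ \<rho>D(2), THEN iffD1, OF _ root])
         (use h_nth[of 0] assms(2) in auto)
    then have \<rho>1: "fps_nth \<rho> 1 = \<epsilon>" and \<rho>v: "\<rho> ^ v\<^sub>0 = mps_subst_fps (\<sigma> 0) \<phi>"
      using q[of 0] \<phi>(4) assms(2) by auto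
    have act_0: "A_act \<rho> \<sigma> \<phi> 0 = fps_X ^ v\<^sub>0"
      unfolding A_act_def \<rho>v[symmetric] by (simp add: \<rho>D flip: fps_compose_power)
    have act_nth: "fps_nth (A_act \<rho> \<sigma> \<phi> k) m = fps_nth (fps_X ^ w k) m" if k: "k \<le> n" and m: "m \<le> w k" for k m
    proof -
      have low': "fps_nth (mps_subst_fps (\<sigma> k) \<phi>) i = 0" if "i < w k" for i
        using q[OF k] low[OF k that] h_nth[OF k, of i] that by simp
      have lead': "fps_nth (mps_subst_fps (\<sigma> k) \<phi>) (w k) = \<epsilon> ^ w k"
        using q[OF k] \<phi>_nth[OF k, of "w k"] h_nth[OF k, of "w k"] by simp
      show ?thesis
      proof (cases "m = w k")
        case True
        have "fps_nth (A_act \<rho> \<sigma> \<phi> k) (w k) =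
            fps_nth (mps_subst_fps (\<sigma> k) \<phi>) (w k) * fps_nth (fps_inv \<rho>) 1 ^ w k"
          unfolding A_act_def by (rule fps_compose_leading(2)[OF \<rho>D(5) low'])
        \<comment> \<open>The inverse of \<open>\<rho>\<close> has derivative
          \<open>1 / \<epsilon>\<close>, so the leading coefficient \<open>\<epsilon> ^ w k\<close>
          is normalized to \<open>1\<close>.\<close>
        also have "\<dots> = 1"
          unfolding lead' \<rho>D(6) \<rho>1 using \<epsilon> by (simp flip: power_mult_distrib)
        finally show ?thesis using True by simp
      next
        case False
        then have "m < w k" using m by simp
        then show ?thesis
          using fps_compose_leading(1)[OF \<rho>D(5) low'] by (simp add: A_act_def)
      qed
    qed
    have "adapted_curve n w (A_act \<rho> \<sigma> \<phi>)"
    proof unfold_locales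
      show "w i \<notin> value_set i (A_act \<rho> \<sigma> \<phi>)" if "i \<le> n" for i
        \<comment> \<open>For \<open>j \<le> k\<close> the series \<open>h k\<close> has no linear
          term in the variable of index \<open>j\<close>, so the Jacobian of \<open>\<sigma>\<close>
          is triangular with diagonal entries \<open>\<epsilon> ^ w k\<close>.\<close>
        by (rule A_act_gap[OF assms(4) that]) (auto simp: \<sigma>_eq hD coeff_var \<epsilon>)
    qed (auto simp: w_pos w_mono act_nth)
    moreover have "fps_ord (A_act \<rho> \<sigma> \<phi> k - fps_X ^ w k) > enat (w k)" if "k \<in> {1..n}" for k
      using that by (auto simp: fps_ord_gt_iff act_nth)
    ultimately show ?lhs
      unfolding P_iff
      using A_act_curve_germs[OF \<phi>(1) assms(4)] A_act_primitive[OF \<phi>(1,2) assms(4)] act_0 by blast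
  qed
qed

end
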